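(* Let $n\ge1$, $p\ge 2$ be integers, $\sigma>0$, $\mathbf f\in\mathbb R^n$, $\boldsymbol\xi\sim\mathcal N(\mathbf 0,\sigma^2I_{n\times n})$, $\mathbf y=\mathbf f+\boldsymbol\xi$, and $\mathbb X\in\mathbb R^{n\times p}$. Assume that the diagonal elements of $\frac1n\mathbb X^T\mathbb X$ are not greater than $1$, and let $\lambda\ge 2\sigma\sqrt{2\log(p)/n}$. Let $\hat{\boldsymbol\beta}$ be the LASSO estimator, $$\hat{\boldsymbol\beta}\in\operatorname*{argmin}_{\boldsymbol\beta\in\mathbb R^p}\left(\|\mathbf y-\mathbb X\boldsymbol\beta\|^2+2\lambda|\boldsymbol\beta|_1\right).$$ Let $S\subset\{1,\dots,p\}$ be nonempty with $\kappa(S,3)>0$, and let $s=|S|$. Then $$\mathbb P\left(\|\mathbb X\hat{\boldsymbol\beta}-\mathbf f\|\le\inf_{\boldsymbol\beta\in\mathbb R^p:\ \operatorname{Supp}(\boldsymbol\beta)=S}\|\mathbb X\boldsymbol\beta-\mathbf f\|+\frac{7\lambda\sqrt{|S|}}{2\kappa(S,3)}\right)\ge 1-e^{-2s\lambda^2n/(\sigma^2\kappa^2(S,3))},$$ and the right-hand side is at least $1-p^{-16s}$.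
   Context: For $\mathbf u\in\mathbb R^n$, $\|\mathbf u\|$ is the scaled Euclidean norm, $\|\mathbf u\|^2=\frac1n\sum_{i=1}^nu_i^2$; $|\cdot|_1$ and $|\cdot|_2$ are the $\ell_1$ and Euclidean norms. $\operatorname{Supp}(\boldsymbol\beta)$ is the set of indices of nonzero components of $\boldsymbol\beta$; for $\mathbf u\in\mathbb R^p$, $\mathbf u_S$ is the vector with components $u_j$ for $j\in S$ and $0$ otherwise. For nonempty $S\subset\{1,\dots,p\}$ and $c_0>0$, the Restricted Eigenvalue constant $\kappa(S,c_0)\ge0$ is defined by $$\kappa^2(S,c_0)=\min_{\boldsymbol\Delta\in\mathbb R^p\setminus\{\mathbf 0\}:\ |\boldsymbol\Delta_{S^c}|_1\le c_0|\boldsymbol\Delta_S|_1}\frac{\|\mathbb X\boldsymbol\Delta\|^2}{|\boldsymbol\Delta|_2^2}.$$ *)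

theory Defs
  imports "HOL-Probability.Probability"
begin

definition multivariate_normal_density ::
    "real ^ 'n \<Rightarrow> real ^ 'n ^ 'n \<Rightarrow> real ^ 'n \<Rightarrow> real" where
  "multivariate_normal_density \<mu> \<Sigma> x =
     exp (- ((x - \<mu>) \<bullet> (matrix_inv \<Sigma> *v (x - \<mu>))) / 2)
       / sqrt ((2 * pi) ^ CARD('n) * det \<Sigma>)"

definition scaled_norm :: "real ^ 'n \<Rightarrow> real" where
  "scaled_norm u = sqrt ((\<Sum>i\<in>UNIV. (u $ i)\<^sup>2) / real CARD('n))"

definition l1_norm :: "real ^ 'p \<Rightarrow> real" where
  "l1_norm u = (\<Sum>j\<in>UNIV. \<bar>u $ j\<bar>)"

definition Supp :: "real ^ 'p \<Rightarrow> 'p set" where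
  "Supp \<beta> = {j. \<beta> $ j \<noteq> 0}"

definition restrict_vec :: "real ^ 'p \<Rightarrow> 'p set \<Rightarrow> real ^ 'p" where
  "restrict_vec u S = (\<chi> j. if j \<in> S then u $ j else 0)"

definition RE_cone :: "'p set \<Rightarrow> real \<Rightarrow> (real ^ 'p) set" where
  "RE_cone S c0 = {\<Delta>. l1_norm (restrict_vec \<Delta> (- S)) \<le> c0 * l1_norm (restrict_vec \<Delta> S)}"

(* The infimum is a minimum for nonempty S: see RE_const_attained. *)
definition RE_const :: "real ^ 'p ^ 'n \<Rightarrow> 'p set \<Rightarrow> real \<Rightarrow> real" where
  "RE_const X S c0 =
     sqrt (INF \<Delta> \<in> RE_cone S c0 - {0}. (scaled_norm (X *v \<Delta>))\<^sup>2 / (norm \<Delta>)\<^sup>2)"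

definition is_lasso :: "real ^ 'p ^ 'n \<Rightarrow> real ^ 'n \<Rightarrow> real \<Rightarrow> real ^ 'p \<Rightarrow> bool" where
  "is_lasso X y lam b \<longleftrightarrow>
     is_arg_min (\<lambda>\<beta>. (scaled_norm (y - X *v \<beta>))\<^sup>2 + 2 * lam * l1_norm \<beta>) (\<lambda>_. True) b"

lemma scaled_norm_scaleR: "scaled_norm (a *\<^sub>R u) = \<bar>a\<bar> * scaled_norm u"
  unfolding scaled_norm_def
  by (simp add: power_mult_distrib sum_distrib_left[symmetric] real_sqrt_mult
      times_divide_eq_right[symmetric] del: times_divide_eq_right)

lemma RE_cone_scaleR:
  assumes "\<Delta> \<in> RE_cone S c0"
  shows "a *\<^sub>R \<Delta> \<in> RE_cone S c0"
proof -
  have r: "l1_norm (restrict_vec (a *\<^sub>R \<Delta>) T) = \<bar>a\<bar> * l1_norm (restrict_vec \<Delta> T)" for T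
    unfolding l1_norm_def restrict_vec_def sum_distrib_left
    by (rule sum.cong) (auto simp: abs_mult)
  have "\<bar>a\<bar> * l1_norm (restrict_vec \<Delta> (- S)) \<le> \<bar>a\<bar> * (c0 * l1_norm (restrict_vec \<Delta> S))"
    using assms by (intro mult_left_mono) (auto simp: RE_cone_def)
  then show ?thesis
    by (simp add: RE_cone_def r mult.left_commute)
qed

lemma RE_const_attained:
  fixes X :: "real ^ 'p ^ 'n" and S :: "'p set"
  assumes S: "S \<noteq> {}" and c0: "c0 > 0"
  obtains D where "D \<in> RE_cone S c0 - {0}"
    and "(RE_const X S c0)\<^sup>2 = (scaled_norm (X *v D))\<^sup>2 / (norm D)\<^sup>2"
    and "\<And>\<Delta>. \<Delta> \<in> RE_cone S c0 - {0} \<Longrightarrow>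
           (RE_const X S c0)\<^sup>2 \<le> (scaled_norm (X *v \<Delta>))\<^sup>2 / (norm \<Delta>)\<^sup>2"
proof -
  let ?C = "RE_cone S c0 - {0}"
  let ?q = "\<lambda>\<Delta>. (scaled_norm (X *v \<Delta>))\<^sup>2 / (norm \<Delta>)\<^sup>2"
  let ?K = "sphere 0 1 \<inter> RE_cone S c0"
  obtain j where j: "j \<in> S" using S by blast
  have "l1_norm (restrict_vec (axis j 1 :: real ^ 'p) (- S)) = 0"
    using j by (auto simp: l1_norm_def restrict_vec_def axis_def intro!: sum.neutral)
  moreover have "0 \<le> l1_norm (restrict_vec (axis j 1 :: real ^ 'p) S)"
    by (simp add: l1_norm_def sum_nonneg)
  ultimately have "axis j 1 \<in> ?K" using c0 by (simp add: RE_cone_def)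
  then have ne: "?K \<noteq> {}" by blast
  have "continuous_on UNIV (\<lambda>\<Delta> :: real ^ 'p. l1_norm (restrict_vec \<Delta> T))" for T
  proof -
    have "(\<lambda>\<Delta> :: real ^ 'p. l1_norm (restrict_vec \<Delta> T))
        = (\<lambda>\<Delta>. \<Sum>j\<in>UNIV. (if j \<in> T then 1 else 0) * \<bar>\<Delta> $ j\<bar>)"
      by (auto simp: l1_norm_def restrict_vec_def fun_eq_iff intro!: sum.cong)
    then show ?thesis by (simp only:) (intro continuous_intros)
  qed
  then have "closed (RE_cone S c0)"
    unfolding RE_cone_def by (intro closed_Collect_le continuous_intros)
  then have cpt: "compact ?K" by (intro compact_Int_closed compact_sphere)
  have cont: "continuous_on ?K ?q"
    unfolding scaled_norm_def matrix_vector_mult_def by (auto intro!: continuous_intros)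
  obtain D where D: "D \<in> ?K" and Dmin: "\<And>\<Delta>. \<Delta> \<in> ?K \<Longrightarrow> ?q D \<le> ?q \<Delta>"
    using continuous_attains_inf[OF cpt ne cont] by blast
  have DC: "D \<in> ?C" using D by auto
  have low: "?q D \<le> ?q \<Delta>" if "\<Delta> \<in> ?C" for \<Delta>
  proof -
    have nz: "norm \<Delta> > 0" using that by simp
    let ?u = "(1 / norm \<Delta>) *\<^sub>R \<Delta>"
    have "?u \<in> ?K" using that nz by (simp add: RE_cone_scaleR)
    then have "?q D \<le> ?q ?u" by (rule Dmin)
    also have "\<dots> = ?q \<Delta>"
      using nz by (simp add: matrix_vector_mult_scaleR scaled_norm_scaleR power_divide)
    finally show ?thesis .
  qed
  have "(INF \<Delta> \<in> ?C. ?q \<Delta>) = ?q D"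
    using DC low by (intro cInf_eq_minimum) auto
  then have eq: "(RE_const X S c0)\<^sup>2 = ?q D" by (simp add: RE_const_def)
  show thesis using that[OF DC eq] low eq by simp
qed

end

theory Submission
  imports Defs
begin

text \<open>Let \<open>z = \<xi> / \<sigma>\<close>, \<open>Y = X / sqrt n\<close>, \<open>lam' = lam * sqrt n / \<sigma>\<close> and \<open>t = 2 * lam' * sqrt s / \<kappa>\<close>, so that the
  exponent of the theorem is \<open>t\<^sup>2 / 2\<close>. By the first order condition at the minimiser the oracle inequality holds
  unless \<open>z\<close> lies in the set \<open>B\<close> of points for which some \<open>\<Delta>\<close> has
  \<open>z \<bullet> Y \<Delta> + lam' (\<bar>\<Delta>\<^sub>S\<bar> - \<bar>\<Delta>\<^sub>S\<^sub>c\<bar>) > (7/4) t \<parallel>Y \<Delta>\<parallel>\<close>. Instead of Gaussian isoperimetry, \<open>B\<close> is bounded by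
  \<open>P(B) \<le> exp (- E g(z))\<close>, valid whenever \<open>g a \<le> \<parallel>b - a\<parallel>\<^sup>2 / 2\<close> for all \<open>b \<in> B\<close> and all \<open>a\<close>; this is a limit of the
  Prekopa-Leindler inequality. In the cone of the restricted eigenvalue condition the distance from \<open>a\<close> to \<open>B\<close> is at
  least \<open>t (5/4 - max \<bar>Y\<^sub>j \<bullet> a\<bar> / (2 lam'))\<close>, up to a term that vanishes unless the maximum exceeds \<open>lam'\<close>, and its mean
  exceeds \<open>t\<close> because the expected maximum of \<open>p \<ge> 16\<close> absolute Gaussians stays below \<open>sqrt (2 ln p)\<close> by a definite
  amount. Outside the cone the distance is at least \<open>(7/4) t\<close> on the event \<open>max \<bar>Y\<^sub>j \<bullet> a\<bar> \<le> lam' / 2\<close>. For \<open>p \<le> 15\<close> the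
  chi-square tail of the projection of \<open>z\<close> onto the range of \<open>Y\<close> already suffices.\<close>

subsection \<open>The Prekopa-Leindler inequality on the line\<close>

lemma emeasure_lborel_translate:
  fixes A :: "real set"
  assumes "A \<in> sets borel"
  shows "emeasure lborel {x. x - t \<in> A} = emeasure lborel A"
proof -
  have [measurable]: "A \<in> sets borel" by fact
  have "emeasure lborel {x. x - t \<in> A} = (\<integral>\<^sup>+x. indicator {x. x - t \<in> A} x \<partial>lborel)"
    by simp
  also have "\<dots> = (\<integral>\<^sup>+x. indicator {x. x - t \<in> A} (t + 1 * x) \<partial>lborel)"
    by (subst nn_integral_real_affine[where c=1 and t=t]) auto
  also have "(\<lambda>x. indicator {x. x - t \<in> A} (t + 1 * x) :: ennreal) = indicator A"
    by (auto simp: indicator_def fun_eq_iff)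
  finally show ?thesis using assms by simp
qed

lemma emeasure_lborel_scale:
  fixes A :: "real set"
  assumes "A \<in> sets borel" "c > 0"
  shows "emeasure lborel {x. x / c \<in> A} = c * emeasure lborel A"
proof -
  have [measurable]: "A \<in> sets borel" by fact
  have "emeasure lborel {x. x / c \<in> A} = (\<integral>\<^sup>+x. indicator {x. x / c \<in> A} x \<partial>lborel)"
    by simp
  also have "\<dots> = c * (\<integral>\<^sup>+x. indicator {x. x / c \<in> A} (0 + c * x) \<partial>lborel)"
    using assms by (subst nn_integral_real_affine[where c=c and t=0]) auto
  also have "(\<lambda>x. indicator {x. x / c \<in> A} (0 + c * x) :: ennreal) = indicator A"
    using assms by (auto simp: indicator_def fun_eq_iff)
  finally show ?thesis using assms by simp
qed

text \<open>One-dimensional Brunn-Minkowski: shift \<open>A\<close> by a nearly minimal point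
  \<open>b\<close> of \<open>B\<close> and \<open>B\<close> by a nearly maximal point
  \<open>a\<close> of \<open>A\<close>; both copies lie in \<open>C\<close>. Working with a Borel
  \<open>C\<close> that contains all sums avoids the question whether the sumset is
  measurable.\<close>

lemma brunn_minkowski_real:
  fixes A B C :: "real set"
  assumes meas: "A \<in> sets borel" "B \<in> sets borel" "C \<in> sets borel"
    and ne: "A \<noteq> {}" "B \<noteq> {}" and bd: "bdd_above A" "bdd_below B"
    and sum: "\<And>a b. a \<in> A \<Longrightarrow> b \<in> B \<Longrightarrow> a + b \<in> C"
  shows "emeasure lborel A + emeasure lborel B \<le> emeasure lborel C"
proof (rule ennreal_le_epsilon)
  fix e :: real assume e: "0 < e"
  have [measurable]: "A \<in> sets borel" "B \<in> sets borel" "C \<in> sets borel" by fact+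
  obtain a where a: "a \<in> A" "Sup A - e / 2 < a"
    using less_cSup_iff[OF ne(1) bd(1), of "Sup A - e / 2"] e by auto
  obtain b where b: "b \<in> B" "b < Inf B + e / 2"
    using cInf_less_iff[OF ne(2) bd(2), of "Inf B + e / 2"] e by auto
  define A' where "A' = {x. x - b \<in> A}"
  define B' where "B' = {x. x - a \<in> B}"
  have [measurable]: "A' \<in> sets borel" "B' \<in> sets borel" by (simp_all add: A'_def B'_def)
  have sub: "A' \<union> B' \<subseteq> C"
    using sum[OF a(1)] sum[OF _ b(1)] unfolding A'_def B'_def by (fastforce simp: algebra_simps)
  \<comment> \<open>The translates overlap only near the sum of the end points.\<close>
  have "A' \<inter> B' \<subseteq> {a + Inf B .. Sup A + b}"
    using cSup_upper[OF _ bd(1)] cInf_lower[OF _ bd(2)] unfolding A'_def B'_def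
    by (fastforce simp: algebra_simps)
  then have "emeasure lborel (A' \<inter> B') \<le> emeasure lborel {a + Inf B .. Sup A + b}"
    by (intro emeasure_mono) auto
  also have "\<dots> \<le> ennreal e" using a b e by (subst emeasure_lborel_Icc_eq) (auto intro!: ennreal_leI)
  finally have o: "emeasure lborel (A' \<inter> B') \<le> ennreal e" .
  have "emeasure lborel A + emeasure lborel B = emeasure lborel A' + emeasure lborel B'"
    unfolding A'_def B'_def by (simp add: emeasure_lborel_translate)
  also have "\<dots> = emeasure lborel (A' \<union> B') + emeasure lborel (A' \<inter> B')"
    by (rule emeasure_Un_Int) auto
  also have "\<dots> \<le> emeasure lborel C + ennreal e"
    using sub o by (intro add_mono emeasure_mono) auto
  finally show "emeasure lborel A + emeasure lborel B \<le> emeasure lborel C + ennreal e" .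
qed

text \<open>Each value \<open>f x\<close> is read as the length of \<open>{0..<f x}\<close> and the
  two integrations are exchanged. Where \<open>f\<close> is negative the interval is empty, in
  agreement with the truncation by \<open>ennreal\<close>.\<close>

lemma (in sigma_finite_measure) nn_integral_layer_cake:
  fixes f :: "'a \<Rightarrow> real"
  assumes [measurable]: "f \<in> borel_measurable M"
  shows "(\<integral>\<^sup>+x. ennreal (f x) \<partial>M) = (\<integral>\<^sup>+r. emeasure M {x \<in> space M. f x > r} * indicator {0..} r \<partial>lborel)"
proof -
  interpret pair_sigma_finite M lborel ..
  have "(\<integral>\<^sup>+x. ennreal (f x) \<partial>M) = (\<integral>\<^sup>+x. (\<integral>\<^sup>+r. indicator {0..<f x} r \<partial>lborel) \<partial>M)"
  proof (rule nn_integral_cong)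
    fix x show "ennreal (f x) = (\<integral>\<^sup>+r. indicator {0..<f x} r \<partial>lborel)"
      by (cases "f x \<ge> 0") (auto simp: ennreal_neg)
  qed
  also have "\<dots> = (\<integral>\<^sup>+x. (\<integral>\<^sup>+r. indicator {x \<in> space M. f x > r} x * indicator {0..} r \<partial>lborel) \<partial>M)"
    by (intro nn_integral_cong) (auto simp: indicator_def)
  also have "\<dots> = (\<integral>\<^sup>+r. (\<integral>\<^sup>+x. indicator {x \<in> space M. f x > r} x * indicator {0..} r \<partial>M) \<partial>lborel)"
  proof (rule Fubini'[symmetric])
    have "(\<lambda>(x, r). indicator {z \<in> space (M \<Otimes>\<^sub>M lborel). f (fst z) > snd z} (x, r) * indicator {0..} r :: ennreal)
      \<in> borel_measurable (M \<Otimes>\<^sub>M lborel)" by measurable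
    then show "(\<lambda>(x, r). indicator {x \<in> space M. f x > r} x * indicator {0..} r :: ennreal)
      \<in> borel_measurable (M \<Otimes>\<^sub>M lborel)"
      by (rule measurable_cong[THEN iffD1, rotated]) (auto simp: space_pair_measure indicator_def)
  qed
  also have "\<dots> = (\<integral>\<^sup>+r. emeasure M {x \<in> space M. f x > r} * indicator {0..} r \<partial>lborel)"
    by (intro nn_integral_cong) (simp add: nn_integral_multc)
  finally show ?thesis .
qed

lemma layer_cake_bounded:
  fixes f :: "real \<Rightarrow> real"
  assumes [measurable]: "f \<in> borel_measurable borel" and "\<And>x. f x \<le> 1"
  shows "(\<integral>\<^sup>+x. ennreal (f x) \<partial>lborel) = (\<integral>\<^sup>+r. emeasure lborel {x. f x > r} * indicator {0..<1} r \<partial>lborel)"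
proof -
  have "{x. r < f x} = {}" if "r \<ge> 1" for r
    using assms(2) that by (auto simp: not_less intro: order_trans)
  then show ?thesis
    unfolding lborel.nn_integral_layer_cake[of f, simplified]
    by (intro nn_integral_cong) (auto simp: indicator_def)
qed

text \<open>Both functions exceed every level below 1, so for each \<open>0 < r < 1\<close>
  Brunn-Minkowski applies to the dilates of \<open>{x. f x > r}\<close> by \<open>1 - s\<close> and
  of \<open>{x. g x > r}\<close> by \<open>s\<close>. Integrating over \<open>r\<close> gives the
  arithmetic form, which is stronger than the geometric one.\<close>

lemma prekopa_leindler_real_normalised:
  fixes f g h :: "real \<Rightarrow> real"
  assumes [measurable]: "f \<in> borel_measurable borel" "g \<in> borel_measurable borel" "h \<in> borel_measurable borel"
    and s: "0 < s" "s < 1"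
    and nonneg: "\<And>x. 0 \<le> f x" "\<And>x. 0 \<le> g x"
    and le1: "\<And>x. f x \<le> 1" "\<And>x. g x \<le> 1"
    and sup1: "\<And>r. r < 1 \<Longrightarrow> \<exists>x. r < f x" "\<And>r. r < 1 \<Longrightarrow> \<exists>x. r < g x"
    and bd: "\<And>r. 0 < r \<Longrightarrow> bounded {x. f x > r}" "\<And>r. 0 < r \<Longrightarrow> bounded {x. g x > r}"
    and fgh: "\<And>x y. f x powr (1 - s) * g y powr s \<le> h ((1 - s) * x + s * y)"
  shows "ennreal (1 - s) * (\<integral>\<^sup>+x. f x \<partial>lborel) + s * (\<integral>\<^sup>+x. g x \<partial>lborel) \<le> (\<integral>\<^sup>+x. h x \<partial>lborel)"
proof -
  have le: "(1 - s) * emeasure lborel {x. f x > r} + s * emeasure lborel {x. g x > r} \<le> emeasure lborel {x. h x > r}"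
    if r: "0 < r" "r < 1" for r
  proof -
    \<comment> \<open>The dilates are written as preimages under division, so that they are visibly
      Borel.\<close>
    let ?A = "{x. x / (1 - s) \<in> {x. f x > r}}" and ?B = "{x. x / s \<in> {x. g x > r}}"
    have eq: "{x. x / c \<in> T} = (\<lambda>x. c *\<^sub>R x) ` T" if "c > 0" for c and T :: "real set"
      using that by (auto simp: image_iff field_simps intro!: bexI[of _ "_ / c"])
    have "bounded ?A" "bounded ?B"
      using s r by (simp_all only: eq diff_gt_0_iff_gt bounded_scaling bd)
    then have b: "bdd_above ?A" "bdd_below ?B" by (auto intro: bounded_imp_bdd_above bounded_imp_bdd_below)
    obtain x y where "r < f x" "r < g y" using sup1 r by blast
    then have "(1 - s) * x \<in> ?A" "s * y \<in> ?B" using s by auto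
    then have ne: "?A \<noteq> {}" "?B \<noteq> {}" by blast+
    have "emeasure lborel ?A + emeasure lborel ?B \<le> emeasure lborel {x. h x > r}"
    proof (rule brunn_minkowski_real)
      show "?A \<in> sets borel" by measurable
      show "?B \<in> sets borel" by measurable
      show "{x. h x > r} \<in> sets borel" by measurable
      fix a b assume ab: "a \<in> ?A" "b \<in> ?B"
      have "r = r powr (1 - s) * r powr s" using r by (simp add: powr_add[symmetric])
      also have "\<dots> < f (a / (1 - s)) powr (1 - s) * g (b / s) powr s"
        using ab r s by (intro mult_strict_mono powr_less_mono2) auto
      also have "\<dots> \<le> h (a + b)" using fgh[of "a / (1 - s)" "b / s"] s by simp
      finally show "a + b \<in> {x. h x > r}" by simp
    qed (use b ne in auto)
    moreover have "emeasure lborel ?A = (1 - s) * emeasure lborel {x. f x > r}"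
      using s by (intro emeasure_lborel_scale) measurable
    moreover have "emeasure lborel ?B = s * emeasure lborel {x. g x > r}"
      using s by (intro emeasure_lborel_scale) measurable
    ultimately show ?thesis by simp
  qed
  have [measurable]: "(\<lambda>r. emeasure lborel {x. u x > r}) \<in> borel_measurable borel"
    if [measurable]: "u \<in> borel_measurable borel" for u :: "real \<Rightarrow> real"
    by measurable
  have "(1 - s) * (\<integral>\<^sup>+x. f x \<partial>lborel) + s * (\<integral>\<^sup>+x. g x \<partial>lborel)
     = (\<integral>\<^sup>+r. (1 - s) * (emeasure lborel {x. f x > r} * indicator {0..<1} r)
         + s * (emeasure lborel {x. g x > r} * indicator {0..<1} r) \<partial>lborel)"
    by (simp add: layer_cake_bounded le1 nn_integral_add nn_integral_cmult)
  also have "\<dots> \<le> (\<integral>\<^sup>+r. emeasure lborel {x. h x > r} * indicator {0..} r \<partial>lborel)"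
  proof (rule nn_integral_mono_AE)
    \<comment> \<open>The level 0 is excluded: superlevel sets are known to be bounded only at
      positive levels, and a single point is null.\<close>
    show "AE r in lborel. (1 - s) * (emeasure lborel {x. f x > r} * indicator {0..<1} r)
         + s * (emeasure lborel {x. g x > r} * indicator {0..<1} r) \<le> emeasure lborel {x. h x > r} * indicator {0..} r"
      using AE_lborel_singleton[of "0::real"] by eventually_elim (use le in \<open>auto simp: indicator_def\<close>)
  qed
  also have "\<dots> = (\<integral>\<^sup>+x. h x \<partial>lborel)"
    by (subst lborel.nn_integral_layer_cake) auto
  finally show ?thesis .
qed

text \<open>Dividing \<open>f\<close> and \<open>g\<close> by their suprema and \<open>h\<close> by
  the weighted geometric mean \<open>H\<close> of these reduces to the normalised case, and weighted
  AM-GM turns the sum into a product. If a supremum is 0, that function vanishes and so does the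
  left side.\<close>

lemma prekopa_leindler_real:
  fixes f g h :: "real \<Rightarrow> real"
  assumes meas [measurable]: "f \<in> borel_measurable borel" "g \<in> borel_measurable borel" "h \<in> borel_measurable borel"
    and s: "0 < s" "s < 1"
    and nonneg: "\<And>x. 0 \<le> f x" "\<And>x. 0 \<le> g x" "\<And>x. 0 \<le> h x"
    and bdd: "bdd_above (range f)" "bdd_above (range g)"
    and bd: "\<And>r. 0 < r \<Longrightarrow> bounded {x. f x > r}" "\<And>r. 0 < r \<Longrightarrow> bounded {x. g x > r}"
    and h: "integrable lborel h"
    and fgh: "\<And>x y. f x powr (1 - s) * g y powr s \<le> h ((1 - s) * x + s * y)"
  shows "(\<integral>x. f x \<partial>lborel) powr (1 - s) * (\<integral>x. g x \<partial>lborel) powr s \<le> (\<integral>x. h x \<partial>lborel)"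
proof (cases "(SUP x. f x) > 0 \<and> (SUP x. g x) > 0")
  case False
  have z: "u = (\<lambda>x. 0)" if "bdd_above (range u)" "\<And>x. 0 \<le> u x" "\<not> (SUP x. u x) > 0" for u :: "real \<Rightarrow> real"
    using cSUP_upper[OF _ that(1)] that(2,3) by (intro ext antisym) (auto simp: not_less intro: order_trans)
  have "f = (\<lambda>x. 0) \<or> g = (\<lambda>x. 0)" using False z[OF bdd(1) nonneg(1)] z[OF bdd(2) nonneg(2)] by blast
  then show ?thesis using nonneg by (auto intro!: integral_nonneg_AE)
next
  case True
  define F G where "F = (SUP x. f x)" and "G = (SUP x. g x)"
  define H where "H = F powr (1 - s) * G powr s"
  have pos: "F > 0" "G > 0" "H > 0" using True by (auto simp: F_def G_def H_def)
  have sup: "\<exists>x. r < u x / (SUP x. u x)" if "bdd_above (range u)" "r < 1" "(SUP x. u x) > 0" for u :: "real \<Rightarrow> real" and r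
    using less_cSUP_iff[of UNIV u "r * (SUP x. u x)"] that by (auto simp: field_simps)
  let ?f = "\<lambda>x. f x / F" and ?g = "\<lambda>x. g x / G" and ?h = "\<lambda>x. h x / H"
  have main: "ennreal (1 - s) * (\<integral>\<^sup>+x. ?f x \<partial>lborel) + ennreal s * (\<integral>\<^sup>+x. ?g x \<partial>lborel) \<le> (\<integral>\<^sup>+x. ?h x \<partial>lborel)"
  proof (rule prekopa_leindler_real_normalised)
    show "?f x \<le> 1" for x using cSUP_upper[OF _ bdd(1), of x] pos by (simp add: F_def)
    show "?g x \<le> 1" for x using cSUP_upper[OF _ bdd(2), of x] pos by (simp add: G_def)
    show "\<exists>x. r < ?f x" if "r < 1" for r using sup[OF bdd(1) that] True by (simp add: F_def)
    show "\<exists>x. r < ?g x" if "r < 1" for r using sup[OF bdd(2) that] True by (simp add: G_def)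
    show "bounded {x. r < ?f x}" if "0 < r" for r using bd(1)[of "r * F"] that pos by (simp add: field_simps)
    show "bounded {x. r < ?g x}" if "0 < r" for r using bd(2)[of "r * G"] that pos by (simp add: field_simps)
    fix x y
    have "?f x powr (1 - s) * ?g y powr s = f x powr (1 - s) * g y powr s / H"
      using pos nonneg by (simp add: powr_divide H_def)
    also have "\<dots> \<le> ?h ((1 - s) * x + s * y)" using fgh pos by (intro divide_right_mono) auto
    finally show "?f x powr (1 - s) * ?g y powr s \<le> ?h ((1 - s) * x + s * y)" .
  qed (use s nonneg pos in auto)
  have hfin: "(\<integral>\<^sup>+x. ?h x \<partial>lborel) = ennreal ((\<integral>x. h x \<partial>lborel) / H)"
    using h nonneg pos by (subst nn_integral_eq_integral) auto
  \<comment> \<open>Finiteness of the integrals of \<open>f\<close> and \<open>g\<close> is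
    inherited from \<open>h\<close> through \<open>main\<close>.\<close>
  have fin: "(\<integral>\<^sup>+x. ?f x \<partial>lborel) < \<infinity>" "(\<integral>\<^sup>+x. ?g x \<partial>lborel) < \<infinity>"
    using main s unfolding hfin by (auto simp: ennreal_mult_eq_top_iff less_top[symmetric] top_unique)
  have int: "integrable lborel ?f" "integrable lborel ?g"
    using fin nonneg pos by (auto simp: integrable_iff_bounded)
  have "ennreal ((1 - s) * (\<integral>x. ?f x \<partial>lborel) + s * (\<integral>x. ?g x \<partial>lborel)) \<le> ennreal ((\<integral>x. h x \<partial>lborel) / H)"
    using main s nonneg pos int unfolding hfin
    by (simp add: nn_integral_eq_integral ennreal_mult'' integral_nonneg_AE flip: ennreal_plus ennreal_mult)
  then have *: "(1 - s) * ((\<integral>x. f x \<partial>lborel) / F) + s * ((\<integral>x. g x \<partial>lborel) / G) \<le> (\<integral>x. h x \<partial>lborel) / H"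
    using nonneg pos by (subst (asm) ennreal_le_iff) (auto intro!: divide_nonneg_nonneg integral_nonneg_AE)
  have nn: "0 \<le> (\<integral>x. f x \<partial>lborel) / F" "0 \<le> (\<integral>x. g x \<partial>lborel) / G"
    using pos nonneg by (auto intro!: divide_nonneg_nonneg integral_nonneg_AE)
  have "((\<integral>x. f x \<partial>lborel) / F) powr (1 - s) * ((\<integral>x. g x \<partial>lborel) / G) powr s
     \<le> (1 - s) * ((\<integral>x. f x \<partial>lborel) / F) + s * ((\<integral>x. g x \<partial>lborel) / G)"
  proof (cases "(\<integral>x. f x \<partial>lborel) / F = 0 \<or> (\<integral>x. g x \<partial>lborel) / G = 0")
    case True
    then show ?thesis
      using s mult_nonneg_nonneg[OF _ nn(1), of "1 - s"] mult_nonneg_nonneg[OF _ nn(2), of s] by auto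
  next
    case False
    then show ?thesis using s nn by (intro Youngs_inequality_0) (auto simp: less_le)
  qed
  also note *
  also have "((\<integral>x. f x \<partial>lborel) / F) powr (1 - s) * ((\<integral>x. g x \<partial>lborel) / G) powr s
     = (\<integral>x. f x \<partial>lborel) powr (1 - s) * (\<integral>x. g x \<partial>lborel) powr s / H"
    using pos nonneg by (simp add: powr_divide H_def integral_nonneg_AE)
  finally show ?thesis using pos by (simp add: divide_le_cancel)
qed

text \<open>From \<open>1 + x\<^sup>2 / 2 \<le> exp (x\<^sup>2 / 2)\<close> the density is at most
  \<open>1 / (1 + x\<^sup>2 / 2)\<close>. This supplies the boundedness hypotheses of
  \<open>prekopa_leindler_real\<close> for the density times a bounded function.\<close>

lemma bounded_superlevel_std_normal_density:
  assumes "0 < r" and "\<And>x. f x \<le> K * std_normal_density x"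
  shows "bounded {x :: real. r < f x}"
proof (rule bounded_subset)
  show "{x. r < f x} \<subseteq> {- (1 + 2 * \<bar>K\<bar> / r) .. 1 + 2 * \<bar>K\<bar> / r}"
  proof
    fix x assume "x \<in> {x. r < f x}"
    then have "r < K * std_normal_density x" using assms(2)[of x] by simp
    also have "\<dots> \<le> \<bar>K\<bar> * std_normal_density x" by (intro mult_right_mono) auto
    also have "\<dots> \<le> \<bar>K\<bar> * (1 / (1 + x\<^sup>2 / 2))"
    proof (intro mult_left_mono)
      have "1 + x\<^sup>2 / 2 \<le> exp (x\<^sup>2 / 2)" by (rule exp_ge_add_one_self)
      moreover have "1 \<le> sqrt (2 * pi)" using pi_gt3 by simp
      ultimately have "(1 + x\<^sup>2 / 2) * 1 \<le> exp (x\<^sup>2 / 2) * sqrt (2 * pi)" by (intro mult_mono) auto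
      moreover have "std_normal_density x = 1 / (exp (x\<^sup>2 / 2) * sqrt (2 * pi))"
        unfolding std_normal_density_def by (simp add: exp_minus field_simps)
      ultimately show "std_normal_density x \<le> 1 / (1 + x\<^sup>2 / 2)"
        by (simp only:) (intro divide_left_mono mult_pos_pos, auto simp: add_pos_nonneg)
    qed simp
    finally have "r * (1 + x\<^sup>2 / 2) < \<bar>K\<bar>" by (subst (asm) times_divide_eq_right, subst (asm) pos_less_divide_eq) (auto simp: add_pos_nonneg)
    then have *: "r * x\<^sup>2 < 2 * \<bar>K\<bar>" using assms(1) by (simp add: algebra_simps)
    show "x \<in> {- (1 + 2 * \<bar>K\<bar> / r) .. 1 + 2 * \<bar>K\<bar> / r}"
    proof (cases "\<bar>x\<bar> \<le> 1")
      case False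
      then have "r * \<bar>x\<bar> * 1 \<le> r * \<bar>x\<bar> * \<bar>x\<bar>" using assms(1) by (intro mult_left_mono) auto
      also have "\<dots> \<le> 2 * \<bar>K\<bar>" using * by (simp add: power2_eq_square mult.assoc)
      finally have "\<bar>x\<bar> \<le> 2 * \<bar>K\<bar> / r" using assms(1) by (simp add: field_simps)
      then show ?thesis by auto
    next
      case True
      moreover have "0 \<le> 2 * \<bar>K\<bar> / r" using assms(1) by simp
      ultimately show ?thesis by auto
    qed
  qed
qed simp

subsection \<open>The Gaussian Prekopa-Leindler inequality\<close>

text \<open>The exponential factor allowed in the hypothesis is exactly the strong log-concavity of
  the density, \<open>(1 - s) * x\<^sup>2 + s * y\<^sup>2 - s * (1 - s) * (x - y)\<^sup>2 = ((1 - s)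
  * x + s * y)\<^sup>2\<close>, so the Lebesgue inequality applies to the density times
  \<open>u\<close>, \<open>v\<close> and \<open>C\<close>.\<close>

lemma gaussian_prekopa_leindler_real:
  fixes u v :: "real \<Rightarrow> real"
  assumes [measurable]: "u \<in> borel_measurable borel" "v \<in> borel_measurable borel"
    and s: "0 < s" "s < 1" and C: "0 \<le> C"
    and u: "\<And>x. 0 \<le> u x" "\<And>x. u x \<le> K" and v: "\<And>x. 0 \<le> v x" "\<And>x. v x \<le> K"
    and uv: "\<And>x y. u x powr (1 - s) * v y powr s \<le> C * exp (s * (1 - s) * (x - y)\<^sup>2 / 2)"
  shows "(\<integral>x. u x \<partial>std_normal_distribution) powr (1 - s) * (\<integral>x. v x \<partial>std_normal_distribution) powr s \<le> C"
proof -
  let ?\<phi> = std_normal_density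
  have bdd: "bdd_above (range (\<lambda>x. ?\<phi> x * w x))" if "\<And>x. 0 \<le> w x" "\<And>x. w x \<le> K" for w
  proof (intro bdd_aboveI2)
    fix x :: real
    have "?\<phi> x \<le> 1 * 1" unfolding std_normal_density_def using pi_gt3
      by (intro mult_mono) auto
    then show "?\<phi> x * w x \<le> 1 * K" using that[of x] by (intro mult_mono) auto
  qed
  have bd: "bounded {x. r < ?\<phi> x * w x}" if "\<And>x. w x \<le> K" "0 < r" for w :: "real \<Rightarrow> real" and r
    using that by (intro bounded_superlevel_std_normal_density[where K=K]) (auto simp: mult.commute[of K] intro!: mult_left_mono)
  have "(\<integral>x. ?\<phi> x * u x \<partial>lborel) powr (1 - s) * (\<integral>x. ?\<phi> x * v x \<partial>lborel) powr s \<le> (\<integral>x. C * ?\<phi> x \<partial>lborel)"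
  proof (rule prekopa_leindler_real)
    fix x y :: real
    let ?z = "(1 - s) * x + s * y"
    define c where "c = 1 / sqrt (2 * pi)"
    have c: "c > 0" by (simp add: c_def)
    have \<phi>: "?\<phi> x = c * exp (- x\<^sup>2 / 2)" for x by (simp add: std_normal_density_def c_def)
    have "(?\<phi> x * u x) powr (1 - s) * (?\<phi> y * v y) powr s
       = (?\<phi> x powr (1 - s) * ?\<phi> y powr s) * (u x powr (1 - s) * v y powr s)"
      using u v by (simp add: powr_mult mult_ac)
    also have "\<dots> \<le> (?\<phi> x powr (1 - s) * ?\<phi> y powr s) * (C * exp (s * (1 - s) * (x - y)\<^sup>2 / 2))"
      by (intro mult_left_mono uv) auto
    also have "?\<phi> x powr (1 - s) * ?\<phi> y powr s = (c powr (1 - s) * c powr s) * (exp (- x\<^sup>2 / 2) powr (1 - s) * exp (- y\<^sup>2 / 2) powr s)"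
      using c unfolding \<phi> by (simp add: powr_mult mult_ac)
    also have "c powr (1 - s) * c powr s = c" using c by (simp add: powr_add[symmetric])
    also have "exp (- x\<^sup>2 / 2) powr (1 - s) * exp (- y\<^sup>2 / 2) powr s = exp (- x\<^sup>2 / 2 * (1 - s) + - y\<^sup>2 / 2 * s)"
      by (simp add: powr_def exp_add[symmetric] mult_ac)
    also have "c * \<dots> * (C * exp (s * (1 - s) * (x - y)\<^sup>2 / 2)) = C * (c * exp (- x\<^sup>2 / 2 * (1 - s) + - y\<^sup>2 / 2 * s + s * (1 - s) * (x - y)\<^sup>2 / 2))"
      by (simp add: exp_add)
    also have "- x\<^sup>2 / 2 * (1 - s) + - y\<^sup>2 / 2 * s + s * (1 - s) * (x - y)\<^sup>2 / 2 = - ?z\<^sup>2 / 2"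
      by (simp add: field_simps power2_eq_square)
    finally show "(?\<phi> x * u x) powr (1 - s) * (?\<phi> y * v y) powr s \<le> C * ?\<phi> ?z"
      by (simp add: \<phi>)
  qed (use s C u v bdd[of u] bdd[of v] bd[of u] bd[of v] in auto)
  then show ?thesis by (simp add: integral_density)
qed

text \<open>Tensorisation: squared distance is additive over coordinates, so after integrating out
  the coordinates in \<open>I\<close> the partial integrals satisfy the one-dimensional hypothesis
  in the remaining coordinate.\<close>

lemma gaussian_prekopa_leindler_PiM:
  fixes u v :: "('i \<Rightarrow> real) \<Rightarrow> real"
  defines "\<gamma> \<equiv> \<lambda>I :: 'i set. PiM I (\<lambda>_. std_normal_distribution)"
  assumes "finite I"
    and "u \<in> borel_measurable (\<gamma> I)" "v \<in> borel_measurable (\<gamma> I)"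
    and s: "0 < s" "s < 1" and "0 \<le> C"
    and "\<And>x. 0 \<le> u x" "\<And>x. u x \<le> K" "\<And>x. 0 \<le> v x" "\<And>x. v x \<le> K"
    and "\<And>x y. x \<in> space (\<gamma> I) \<Longrightarrow> y \<in> space (\<gamma> I) \<Longrightarrow>
           u x powr (1 - s) * v y powr s \<le> C * exp (s * (1 - s) * (\<Sum>i\<in>I. (x i - y i)\<^sup>2) / 2)"
  shows "(\<integral>x. u x \<partial>\<gamma> I) powr (1 - s) * (\<integral>x. v x \<partial>\<gamma> I) powr s \<le> C"
  using assms(2-4,7-)
\<comment> \<open>\<open>C\<close> must vary: with the new coordinate frozen at \<open>a\<close> and
  \<open>b\<close>, the induction hypothesis is used with
  \<open>C * exp (s * (1 - s) * (a - b)\<^sup>2 / 2)\<close>.\<close>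
proof (induction I arbitrary: u v C rule: finite_induct)
  case empty
  have "space (\<gamma> {}) = {\<lambda>_. undefined}" by (simp add: \<gamma>_def space_PiM)
  with empty(8)[of "\<lambda>_. undefined" "\<lambda>_. undefined"] show ?case
    unfolding \<gamma>_def using empty(4,6) by (simp add: PiM_empty lebesgue_integral_count_space_finite)
next
  case (insert i I)
  interpret N: prob_space std_normal_distribution using prob_space_normal_density by simp
  interpret PP: product_prob_space "\<lambda>_::'i. std_normal_distribution" I ..
  interpret GI: prob_space "\<gamma> I" unfolding \<gamma>_def by (rule prob_space_PiM) unfold_locales
  interpret GJ: prob_space "\<gamma> (insert i I)" unfolding \<gamma>_def by (rule prob_space_PiM) unfold_locales
  have setsN: "sets (\<gamma> J) = sets (PiM J (\<lambda>_. borel))" for J unfolding \<gamma>_def by (intro sets_PiM_cong) auto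
  note [measurable_cong] = setsN
  have upd: "(\<lambda>p. (fst p)(i := snd p)) \<in> measurable (\<gamma> I \<Otimes>\<^sub>M borel) (\<gamma> (insert i I))"
  proof -
    have "fst \<in> measurable (\<gamma> I \<Otimes>\<^sub>M borel) (PiM I (\<lambda>_. borel :: real measure))"
      by (rule measurable_fst'') (simp add: measurable_ident_sets[OF setsN])
    then have "(\<lambda>p. (fst p)(i := snd p)) \<in> measurable (\<gamma> I \<Otimes>\<^sub>M borel) (PiM (insert i I) (\<lambda>_. borel))"
      by (intro measurable_fun_upd[where J=I]) auto
    then show ?thesis by (simp add: measurable_cong_sets[OF refl setsN])
  qed
  define U V where "U = (\<lambda>t. \<integral>x. u (x(i := t)) \<partial>\<gamma> I)" and "V = (\<lambda>t. \<integral>x. v (x(i := t)) \<partial>\<gamma> I)"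
  have key: "(\<lambda>t. \<integral>x. w (x(i := t)) \<partial>\<gamma> I) \<in> borel_measurable borel
     \<and> (\<integral>x. w x \<partial>\<gamma> (insert i I)) = (\<integral>t. (\<integral>x. w (x(i := t)) \<partial>\<gamma> I) \<partial>std_normal_distribution)
     \<and> (\<forall>t. 0 \<le> (\<integral>x. w (x(i := t)) \<partial>\<gamma> I) \<and> (\<integral>x. w (x(i := t)) \<partial>\<gamma> I) \<le> K)
     \<and> (\<forall>t. (\<lambda>x. w (x(i := t))) \<in> borel_measurable (\<gamma> I))"
    if w [measurable]: "w \<in> borel_measurable (\<gamma> (insert i I))" and wb: "\<And>x. 0 \<le> w x" "\<And>x. w x \<le> K" for w
  proof (intro conjI allI)
    have m: "(\<lambda>p. w ((fst p)(i := snd p))) \<in> borel_measurable (\<gamma> I \<Otimes>\<^sub>M borel)"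
      using measurable_compose[OF upd w] .
    have m': "(\<lambda>p. w ((snd p)(i := fst p))) \<in> borel_measurable (borel \<Otimes>\<^sub>M \<gamma> I)"
      using measurable_compose[OF measurable_pair_swap' m] by (simp add: case_prod_beta)
    then show "(\<lambda>t. \<integral>x. w (x(i := t)) \<partial>\<gamma> I) \<in> borel_measurable borel"
      by (intro GI.borel_measurable_lebesgue_integral) (simp add: case_prod_beta)
    show mt: "(\<lambda>x. w (x(i := t))) \<in> borel_measurable (\<gamma> I)" for t
      using measurable_compose[OF measurable_Pair2' m, of t] by simp
    show "0 \<le> (\<integral>x. w (x(i := t)) \<partial>\<gamma> I)" for t using wb by (intro integral_nonneg_AE) auto
    have it: "integrable (\<gamma> I) (\<lambda>x. w (x(i := t)))" for t
      using wb mt by (intro GI.integrable_const_bound[where B=K]) (auto simp: abs_of_nonneg)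
    show "(\<integral>x. w (x(i := t)) \<partial>\<gamma> I) \<le> K" for t
      using wb it by (intro GI.integral_le_const) auto
    have "integrable (\<gamma> (insert i I)) w" using wb by (intro GJ.integrable_const_bound[where B=K]) (auto simp: abs_of_nonneg)
    then have "(\<integral>x. w x \<partial>\<gamma> (insert i I)) = (\<integral>x. (\<integral>t. w (x(i := t)) \<partial>std_normal_distribution) \<partial>\<gamma> I)"
      unfolding \<gamma>_def using insert by (intro PP.product_integral_insert) auto
    also have "\<dots> = (\<integral>t. (\<integral>x. w (x(i := t)) \<partial>\<gamma> I) \<partial>std_normal_distribution)"
    proof -
      interpret pp: pair_prob_space "\<gamma> I" std_normal_distribution ..
      have "integrable (\<gamma> I \<Otimes>\<^sub>M std_normal_distribution) (\<lambda>(x, t). w (x(i := t)))"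
        using wb m by (intro pp.P.integrable_const_bound[where B=K]) (auto simp: abs_of_nonneg case_prod_beta)
      then show ?thesis by (rule pp.Fubini_integral[symmetric])
    qed
    finally show "(\<integral>x. w x \<partial>\<gamma> (insert i I)) = (\<integral>t. (\<integral>x. w (x(i := t)) \<partial>\<gamma> I) \<partial>std_normal_distribution)" .
  qed
  note ku = key[OF insert.prems(1) insert.prems(4,5)] and kv = key[OF insert.prems(2) insert.prems(6,7)]
  have "U a powr (1 - s) * V b powr s \<le> C * exp (s * (1 - s) * (a - b)\<^sup>2 / 2)" for a b
    unfolding U_def V_def
  proof (rule insert.IH)
    fix x y assume xy: "x \<in> space (\<gamma> I)" "y \<in> space (\<gamma> I)"
    have sp: "x(i := a) \<in> space (\<gamma> (insert i I))" if "x \<in> space (\<gamma> I)" for x a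
      using that by (auto simp: \<gamma>_def space_PiM PiE_def extensional_def)
    have eq: "(\<Sum>j\<in>insert i I. ((x(i := a)) j - (y(i := b)) j)\<^sup>2) = (a - b)\<^sup>2 + (\<Sum>j\<in>I. (x j - y j)\<^sup>2)"
      using insert.hyps by (auto intro!: sum.cong)
    show "u (x(i := a)) powr (1 - s) * v (y(i := b)) powr s
      \<le> C * exp (s * (1 - s) * (a - b)\<^sup>2 / 2) * exp (s * (1 - s) * (\<Sum>i\<in>I. (x i - y i)\<^sup>2) / 2)"
      using insert.prems(8)[OF sp[OF xy(1), of a] sp[OF xy(2), of b]] unfolding eq
      by (simp add: exp_add[symmetric] mult.assoc add_divide_distrib distrib_left del: fun_upd_apply)
  qed (use insert.prems ku kv in \<open>auto simp del: fun_upd_apply\<close>)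
  then have "(\<integral>t. U t \<partial>std_normal_distribution) powr (1 - s) * (\<integral>t. V t \<partial>std_normal_distribution) powr s \<le> C"
    using ku kv s insert.prems(3) unfolding U_def V_def
    by (intro gaussian_prekopa_leindler_real[where K=K]) (auto simp del: fun_upd_apply)
  then show ?case using ku kv by (simp add: U_def V_def del: fun_upd_apply)
qed

subsection \<open>Gaussian concentration\<close>

text \<open>Built from independent coordinates so that the tensorised inequality applies directly;
  the Lebesgue density is recovered in \<open>std_gaussian_eq_density\<close>.\<close>

definition std_gaussian :: "'a::euclidean_space measure" where
  "std_gaussian = distr (PiM Basis (\<lambda>_. std_normal_distribution)) borel (\<lambda>f. \<Sum>b\<in>Basis. f b *\<^sub>R b)"

lemma sets_std_gaussian [simp, measurable_cong]: "sets std_gaussian = sets borel"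
  by (simp add: std_gaussian_def)

lemma space_std_gaussian [simp]: "space std_gaussian = UNIV"
  by (simp add: std_gaussian_def)

lemma measurable_from_coordinates:
  "(\<lambda>f. \<Sum>b\<in>Basis. f b *\<^sub>R b) \<in> borel_measurable (PiM (Basis :: 'a::euclidean_space set) (\<lambda>_. std_normal_distribution))"
proof (intro borel_measurable_sum borel_measurable_scaleR)
  fix b :: 'a assume "b \<in> Basis"
  then show "(\<lambda>f. f b) \<in> borel_measurable (PiM Basis (\<lambda>_. std_normal_distribution))"
    using measurable_component_singleton[of b Basis "\<lambda>_. std_normal_distribution"] by simp
qed simp

lemma prob_space_std_gaussian: "prob_space (std_gaussian :: 'a::euclidean_space measure)"
  unfolding std_gaussian_def
  by (intro prob_space.prob_space_distr prob_space_PiM measurable_from_coordinates prob_space_normal_density) simp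

text \<open>Prekopa-Leindler with weight \<open>e\<close> on the indicator of \<open>B\<close> and
  \<open>1 - e\<close> on \<open>exp (e * g)\<close> has constant 1, which is what \<open>le\<close>
  provides. Bounding the mean of \<open>exp (e * g)\<close> below by Jensen gives
  \<open>ln p + (1 - e) * m \<le> 0\<close>; then \<open>e\<close> tends to 0. The bound
  \<open>K\<close> keeps \<open>exp (e * g)\<close> bounded.\<close>

lemma std_gaussian_measure_le_exp:
  fixes B :: "'a::euclidean_space set" and g :: "'a \<Rightarrow> real"
  assumes B [measurable]: "B \<in> sets borel"
    and g: "integrable std_gaussian g" "\<And>a. g a \<le> K"
    and le: "\<And>z a. z \<in> B \<Longrightarrow> g a \<le> (norm (z - a))\<^sup>2 / 2"
  shows "measure std_gaussian B \<le> exp (- (\<integral>a. g a \<partial>std_gaussian))"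
proof (cases "measure (std_gaussian :: 'a measure) B = 0")
  case True
  then show ?thesis by simp
next
  case False
  let ?G = "std_gaussian :: 'a measure" and ?P = "PiM (Basis :: 'a set) (\<lambda>_. std_normal_distribution)"
  let ?T = "\<lambda>f. \<Sum>b\<in>(Basis :: 'a set). f b *\<^sub>R b"
  interpret prob_space ?G by (rule prob_space_std_gaussian)
  note [measurable] = measurable_from_coordinates[where 'a='a]
  have gm [measurable]: "g \<in> borel_measurable borel" using borel_measurable_integrable[OF g(1)] by simp
  define p m where "p = measure ?G B" and "m = (\<integral>a. g a \<partial>?G)"
  have p: "p > 0" using False by (simp add: p_def less_le)
  have dist: "(norm (?T x - ?T y))\<^sup>2 = (\<Sum>b\<in>Basis. (x b - y b)\<^sup>2)" for x y :: "'a \<Rightarrow> real"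
    by (subst norm_eq_sqrt_inner, subst euclidean_inner)
       (auto simp: inner_diff_left inner_sum_left inner_Basis if_distrib sum_nonneg power2_eq_square cong: if_cong)
  have bound: "p \<le> exp (- ((1 - e) * m))" if e: "0 < e" "e < 1" for e
  proof -
    \<comment> \<open>One constant bounding both the indicator and \<open>exp (e * g)\<close>, as
      the product inequality expects.\<close>
    define L where "L = max 1 (exp (e * K))"
    have L: "1 \<le> L" "exp (e * g a) \<le> L" for a using e g(2)[of a] by (auto simp: L_def intro!: max.coboundedI2)
    have "(\<integral>x. indicator B (?T x) \<partial>?P) powr (1 - (1 - e)) * (\<integral>x. exp (e * g (?T x)) \<partial>?P) powr (1 - e) \<le> 1"
    proof (rule gaussian_prekopa_leindler_PiM[where K=L])
      fix x y :: "'a \<Rightarrow> real"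
      show "indicator B (?T x) powr (1 - (1 - e)) * exp (e * g (?T y)) powr (1 - e)
        \<le> 1 * exp ((1 - e) * (1 - (1 - e)) * (\<Sum>i\<in>Basis. (x i - y i)\<^sup>2) / 2)"
      proof (cases "?T x \<in> B")
        case True
        have "(1 - e) * e * g (?T y) \<le> (1 - e) * e * ((norm (?T x - ?T y))\<^sup>2 / 2)"
          using e by (intro mult_left_mono le True) auto
        then show ?thesis using True unfolding dist by (simp add: powr_def mult_ac)
      qed simp
      show "indicator B (?T x) \<le> L" using L by (auto simp: indicator_def)
    qed (use e L in auto)
    also have "(\<integral>x. indicator B (?T x) \<partial>?P :: real) = (\<integral>x. indicator B x \<partial>?G)"
      unfolding std_gaussian_def by (rule integral_distr[symmetric]) auto
    also have "\<dots> = p" by (simp add: p_def)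
    also have "(\<integral>x. exp (e * g (?T x)) \<partial>?P) = (\<integral>x. exp (e * g x) \<partial>?G)"
      unfolding std_gaussian_def by (rule integral_distr[symmetric]) auto
    finally have *: "p powr e * (\<integral>x. exp (e * g x) \<partial>?G) powr (1 - e) \<le> 1" by simp
    \<comment> \<open>Jensen, by the tangent of the exponential function at \<open>e * m\<close>.\<close>
    have "exp (e * m) = (\<integral>x. exp (e * m) * (1 + e * (g x - m)) \<partial>?G)"
      using g(1) prob_space by (simp add: m_def)
    also have "\<dots> \<le> (\<integral>x. exp (e * g x) \<partial>?G)"
    proof (rule integral_mono)
      show "integrable ?G (\<lambda>x. exp (e * g x))"
        using L by (intro integrable_const_bound[where B=L]) auto
      fix x
      have "exp (e * m) * (1 + e * (g x - m)) \<le> exp (e * m) * exp (e * (g x - m))"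
        by (intro mult_left_mono exp_ge_add_one_self) auto
      then show "exp (e * m) * (1 + e * (g x - m)) \<le> exp (e * g x)"
        by (simp add: exp_add[symmetric] algebra_simps)
    qed (use g(1) in auto)
    finally have "p powr e * exp (e * m) powr (1 - e) \<le> p powr e * (\<integral>x. exp (e * g x) \<partial>?G) powr (1 - e)"
      using e by (intro mult_left_mono powr_mono2) auto
    with * have "p powr e * exp (e * m) powr (1 - e) \<le> 1" by linarith
    then have "exp (e * (ln p + (1 - e) * m)) \<le> 1"
      using p by (simp add: powr_def exp_add[symmetric] algebra_simps)
    then have "ln p + (1 - e) * m \<le> 0" using e by (simp add: mult_le_0_iff)
    then have "exp (ln p) \<le> exp (- ((1 - e) * m))" by simp
    then show ?thesis using p by simp
  qed
  \<comment> \<open>The offset 2 keeps \<open>1 / real (n + 2)\<close> strictly between 0 and 1,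
    where \<open>bound\<close> applies.\<close>
  have "(\<lambda>n. exp (- ((1 - 1 / real (n + 2)) * m))) \<longlonglongrightarrow> exp (- ((1 - 0) * m))"
    by (intro tendsto_intros LIMSEQ_ignore_initial_segment lim_1_over_n)
  then have "p \<le> exp (- ((1 - 0) * m))"
    by (rule tendsto_lowerbound) (auto intro!: always_eventually bound)
  then show ?thesis by (simp add: p_def m_def)
qed

text \<open>The parabola \<open>d\<^sup>2 / 2\<close> lies above its tangent
  \<open>m * d - m\<^sup>2 / 2\<close>. Using the tangent as \<open>g\<close> makes the distance
  bound \<open>D\<close> enter linearly, so that only its mean has to be estimated.\<close>

lemma std_gaussian_concentration:
  fixes B :: "'a::euclidean_space set" and D :: "'a \<Rightarrow> real"
  assumes "B \<in> sets borel" and D: "integrable std_gaussian D" "\<And>a. D a \<le> K"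
    and le: "\<And>z a. z \<in> B \<Longrightarrow> D a \<le> norm (z - a)"
    and m: "0 \<le> m" "m \<le> (\<integral>a. D a \<partial>std_gaussian)"
  shows "measure std_gaussian B \<le> exp (- m\<^sup>2 / 2)"
proof -
  interpret prob_space "std_gaussian :: 'a measure" by (rule prob_space_std_gaussian)
  have "measure std_gaussian B \<le> exp (- (\<integral>a. m * D a - m\<^sup>2 / 2 \<partial>std_gaussian))"
  proof (rule std_gaussian_measure_le_exp)
    show "m * D a - m\<^sup>2 / 2 \<le> m * K - m\<^sup>2 / 2" for a using D(2) m(1) by (simp add: mult_left_mono)
    fix z a assume "z \<in> B"
    have "m * D a \<le> m * norm (z - a)" using le[OF \<open>z \<in> B\<close>] m(1) by (simp add: mult_left_mono)
    moreover have "0 \<le> (norm (z - a) - m)\<^sup>2" by simp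
    ultimately show "m * D a - m\<^sup>2 / 2 \<le> (norm (z - a))\<^sup>2 / 2" by (simp add: power2_eq_square algebra_simps)
  qed (use assms in auto)
  also have "(\<integral>a. m * D a - m\<^sup>2 / 2 \<partial>std_gaussian) = m * (\<integral>a. D a \<partial>std_gaussian) - m\<^sup>2 / 2"
    using D(1) prob_space by simp
  also have "exp (- \<dots>) \<le> exp (- m\<^sup>2 / 2)"
    using mult_left_mono[OF m(2,1)] by (simp add: power2_eq_square)
  finally show ?thesis .
qed

subsection \<open>Gaussian tails\<close>

text \<open>The derivative of the density is \<open>- x\<close> times the density, so the integrand
  has the antiderivative \<open>?F\<close>. The free coefficients \<open>a\<close> and
  \<open>b\<close> are chosen later to dominate different tail functions at the price of a boundary
  value at \<open>u\<close>.\<close>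

lemma nn_integral_std_normal_tail:
  assumes nonneg: "\<And>x. u \<le> x \<Longrightarrow> 0 \<le> x * (a + b * x) - b"
  shows "(\<integral>\<^sup>+x. ennreal (std_normal_density x * (x * (a + b * x) - b)) * indicator {u..} x \<partial>lborel)
    = std_normal_density u * (a + b * u)"
proof -
  let ?F = "\<lambda>x. - (std_normal_density x * (a + b * x))"
  have "(\<integral>\<^sup>+x. ennreal (std_normal_density x * (x * (a + b * x) - b)) * indicator {u..} x \<partial>lborel) = 0 - ?F u"
  proof (rule nn_integral_FTC_atLeast)
    show "(?F has_real_derivative std_normal_density x * (x * (a + b * x) - b)) (at x)" for x
    proof -
      define c where "c = 1 / sqrt (2 * pi)"
      show ?thesis
        unfolding std_normal_density_def c_def[symmetric]
        by (auto intro!: derivative_eq_intros simp: algebra_simps power2_eq_square)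
    qed
    show "0 \<le> std_normal_density x * (x * (a + b * x) - b)" if "u \<le> x" for x
      using nonneg[OF that] by simp
    \<comment> \<open>The boundary term at infinity: for \<open>x \<ge> 2\<close> the density is at
      most \<open>exp (- x)\<close>, which beats the linear factor.\<close>
    have "((\<lambda>x. \<bar>a\<bar> * (x ^ 0 / exp x) + \<bar>b\<bar> * (x ^ 1 / exp x)) \<longlongrightarrow> \<bar>a\<bar> * 0 + \<bar>b\<bar> * 0) at_top"
      by (intro tendsto_intros tendsto_power_div_exp_0)
    then have lim: "((\<lambda>x. \<bar>a\<bar> * (x ^ 0 / exp x) + \<bar>b\<bar> * (x ^ 1 / exp x)) \<longlongrightarrow> 0) at_top" by simp
    show "(?F \<longlongrightarrow> 0) at_top"
    proof (rule Lim_null_comparison[OF _ lim])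
      show "eventually (\<lambda>x. norm (?F x) \<le> \<bar>a\<bar> * (x ^ 0 / exp x) + \<bar>b\<bar> * (x ^ 1 / exp x)) at_top"
        using eventually_ge_at_top[of 2]
      proof eventually_elim
        fix x :: real assume x: "2 \<le> x"
        have "1 \<le> sqrt (2 * pi)" using pi_gt3 by simp
        then have "std_normal_density x \<le> 1 * exp (- x\<^sup>2 / 2)"
          unfolding std_normal_density_def by (intro mult_right_mono) auto
        also have "\<dots> \<le> exp (- x)" using mult_right_mono[OF x, of x] x by (simp add: power2_eq_square)
        finally have "\<bar>std_normal_density x * (a + b * x)\<bar> \<le> exp (- x) * \<bar>a + b * x\<bar>"
          by (simp add: abs_mult mult_right_mono)
        also have "\<dots> \<le> exp (- x) * (\<bar>a\<bar> + \<bar>b\<bar> * x)"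
          using x abs_triangle_ineq[of a "b * x"] by (intro mult_left_mono) (auto simp: abs_mult)
        also have "\<dots> = \<bar>a\<bar> * (x ^ 0 / exp x) + \<bar>b\<bar> * (x ^ 1 / exp x)"
          by (simp add: exp_minus divide_inverse algebra_simps)
        finally show "norm (?F x) \<le> \<bar>a\<bar> * (x ^ 0 / exp x) + \<bar>b\<bar> * (x ^ 1 / exp x)" by simp
      qed
    qed
  qed simp
  then show ?thesis by simp
qed

lemma nn_integral_std_normal_even_tail_le:
  fixes k :: "real \<Rightarrow> real"
  assumes [measurable]: "k \<in> borel_measurable borel"
    and even: "\<And>x. k (- x) = k x" and zero: "\<And>x. \<bar>x\<bar> < u \<Longrightarrow> k x = 0" and u: "0 < u"
    and le: "\<And>x. u \<le> x \<Longrightarrow> k x \<le> x * (a + b * x) - b"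
    and nonneg: "\<And>x. u \<le> x \<Longrightarrow> 0 \<le> x * (a + b * x) - b" and ab: "0 \<le> a + b * u"
  shows "(\<integral>\<^sup>+x. ennreal (std_normal_density x * k x) \<partial>lborel) \<le> 2 * (std_normal_density u * (a + b * u))"
proof -
  let ?h = "\<lambda>x. ennreal (std_normal_density x * k x) * indicator {u..} x"
  define c where "c = std_normal_density u * (a + b * u)"
  have "(\<integral>\<^sup>+x. ?h x \<partial>lborel) \<le> (\<integral>\<^sup>+x. ennreal (std_normal_density x * (x * (a + b * x) - b)) * indicator {u..} x \<partial>lborel)"
    using le by (intro nn_integral_mono) (auto simp: indicator_def intro!: ennreal_leI mult_left_mono)
  also have "\<dots> = ennreal c" unfolding c_def by (rule nn_integral_std_normal_tail[OF nonneg])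
  finally have h: "(\<integral>\<^sup>+x. ?h x \<partial>lborel) \<le> ennreal c" .
  have "(\<integral>\<^sup>+x. ennreal (std_normal_density x * k x) \<partial>lborel) = (\<integral>\<^sup>+x. ?h x + ?h (0 + (- 1) * x) \<partial>lborel)"
  proof (rule nn_integral_cong)
    fix x :: real
    have [simp]: "std_normal_density (- x) = std_normal_density x" by (simp add: std_normal_density_def)
    show "ennreal (std_normal_density x * k x) = ?h x + ?h (0 + (- 1) * x)"
      using even[of x] zero[of x] u by (cases "\<bar>x\<bar> < u") (auto simp: indicator_def)
  qed
  also have "\<dots> = (\<integral>\<^sup>+x. ?h x \<partial>lborel) + (\<integral>\<^sup>+x. ?h x \<partial>lborel)"
  proof -
    have "(\<integral>\<^sup>+x. ?h x \<partial>lborel) = (\<integral>\<^sup>+x. ?h (0 + (- 1) * x) \<partial>lborel)"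
      by (subst nn_integral_real_affine[where c="- 1" and t=0]) simp_all
    then show ?thesis by (subst nn_integral_add) simp_all
  qed
  also have "\<dots> \<le> ennreal c + ennreal c" by (intro add_mono h)
  also have "\<dots> = ennreal (c + c)" using ab by (intro ennreal_plus[symmetric]) (auto simp: c_def)
  finally show ?thesis by (simp only: c_def mult_2)
qed

section \<open>Linear functionals of a standard Gaussian vector\<close>

lemma distributed_inner_std_gaussian:
  fixes v :: "'a::euclidean_space"
  assumes "v \<noteq> 0"
  shows "distributed std_gaussian lborel (\<lambda>z. v \<bullet> z) (normal_density 0 (norm v))"
proof -
  let ?P = "PiM (Basis :: 'a set) (\<lambda>_. std_normal_distribution)"
  let ?T = "\<lambda>f. \<Sum>b\<in>(Basis :: 'a set). f b *\<^sub>R b"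
  note [measurable] = measurable_from_coordinates[where 'a='a]
  interpret N: prob_space std_normal_distribution using prob_space_normal_density by simp
  interpret Q: prob_space ?P by (rule prob_space_PiM) (rule N.prob_space_axioms)
  \<comment> \<open>Coordinates with \<open>v \<bullet> b = 0\<close> are dropped, because a summand
    of zero variance has no normal density.\<close>
  define I where "I = {b \<in> (Basis :: 'a set). v \<bullet> b \<noteq> 0}"
  have I: "finite I" "I \<subseteq> Basis" "I \<noteq> {}"
    using assms by (auto simp: I_def euclidean_eq_iff[of v 0])
  have sets_eq: "sets ?P = sets (PiM Basis (\<lambda>_. borel))" by (intro sets_PiM_cong) auto
  have rv: "(\<lambda>f. f b) \<in> borel_measurable ?P" if "b \<in> Basis" for b
    using measurable_component_singleton[of b Basis "\<lambda>_. std_normal_distribution"] that by simp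
  have comp: "distr ?P borel (\<lambda>f. f b) = std_normal_distribution" if "b \<in> Basis" for b :: 'a
  proof -
    have "distr ?P borel (\<lambda>f. f b) = distr ?P std_normal_distribution (\<lambda>f. f b)" by (rule distr_cong) auto
    also have "\<dots> = std_normal_distribution" using that by (intro distr_PiM_component) (auto intro: N.prob_space_axioms)
    finally show ?thesis .
  qed
  \<comment> \<open>Independence of the coordinates is read off from the joint law being the product
    of its marginals.\<close>
  have "distr ?P (PiM Basis (\<lambda>_. borel)) (\<lambda>f. \<lambda>b\<in>Basis. f b) = distr ?P ?P (\<lambda>f. f)"
    by (rule distr_cong[OF refl sets_eq[symmetric]]) (auto simp: space_PiM PiE_def extensional_restrict)
  also have "\<dots> = ?P" by (rule distr_id)
  also have "\<dots> = PiM Basis (\<lambda>b. distr ?P borel (\<lambda>f. f b))"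
    by (rule PiM_cong[OF refl]) (rule comp[symmetric])
  finally have eq: "distr ?P (PiM Basis (\<lambda>_. borel)) (\<lambda>f. \<lambda>b\<in>Basis. f b) = PiM Basis (\<lambda>b. distr ?P borel (\<lambda>f. f b))" .
  have "Q.indep_vars (\<lambda>_. borel) (\<lambda>b f. f b) (Basis :: 'a set)"
    by (rule Q.indep_vars_iff_distr_eq_PiM'[THEN iffD2, OF nonempty_Basis rv eq])
  then have "Q.indep_vars (\<lambda>_. borel) (\<lambda>b f. f b) I" using I(2) by (rule Q.indep_vars_subset)
  then have "Q.indep_vars (\<lambda>_. borel) (\<lambda>b f. (v \<bullet> b) * f b) I"
    by (rule Q.indep_vars_compose2) simp
  moreover have "distributed ?P lborel (\<lambda>f. (v \<bullet> b) * f b) (normal_density 0 \<bar>v \<bullet> b\<bar>)" if "b \<in> I" for b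
  proof -
    have "distributed ?P lborel (\<lambda>f. f b) (normal_density 0 1)"
    proof -
      have "distr ?P lborel (\<lambda>f. f b) = distr ?P borel (\<lambda>f. f b)" by (rule distr_cong) auto
      then show ?thesis using comp rv that I(2) by (auto simp: distributed_def)
    qed
    from Q.normal_density_affine[OF this, of "v \<bullet> b" 0] show ?thesis using that by (simp add: I_def)
  qed
  ultimately have "distributed ?P lborel (\<lambda>f. \<Sum>b\<in>I. (v \<bullet> b) * f b) (normal_density (\<Sum>b\<in>I. 0) (sqrt (\<Sum>b\<in>I. \<bar>v \<bullet> b\<bar>\<^sup>2)))"
    using I by (intro Q.sum_indep_normal) (auto simp: I_def)
  also have "(\<Sum>b\<in>I. \<bar>v \<bullet> b\<bar>\<^sup>2) = v \<bullet> v"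
    unfolding euclidean_inner[of v v] I_def by (intro sum.mono_neutral_cong_left) (auto simp: power2_eq_square)
  also have "(\<lambda>f. \<Sum>b\<in>I. (v \<bullet> b) * f b) = (\<lambda>f. v \<bullet> ?T f)"
    unfolding I_def inner_sum_right by (intro ext sum.mono_neutral_cong_left) auto
  finally have "distributed ?P lborel (\<lambda>f. v \<bullet> ?T f) (normal_density 0 (norm v))"
    by (simp add: norm_eq_sqrt_inner)
  then show ?thesis
    unfolding distributed_def std_gaussian_def by (simp add: distr_distr comp_def)
qed

text \<open>Since \<open>k\<close> grows with the absolute value, \<open>v\<close> may be replaced
  by the unit vector in its direction; the integral then becomes one-dimensional.\<close>

lemma std_gaussian_even_tail_le:
  fixes v :: "'a::euclidean_space" and k :: "real \<Rightarrow> real"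
  assumes v: "norm v \<le> 1" and k: "k \<in> borel_measurable borel" "\<And>x. 0 \<le> k x"
    and mono: "\<And>x y. \<bar>x\<bar> \<le> \<bar>y\<bar> \<Longrightarrow> k x \<le> k y" and zero: "\<And>x. \<bar>x\<bar> < u \<Longrightarrow> k x = 0" and u: "0 < u"
    and le: "\<And>x. u \<le> x \<Longrightarrow> k x \<le> x * (a + b * x) - b" and ab: "0 \<le> a + b * u"
  shows "integrable std_gaussian (\<lambda>z. k (v \<bullet> z))"
    and "(\<integral>z. k (v \<bullet> z) \<partial>std_gaussian) \<le> 2 * (std_normal_density u * (a + b * u))"
proof -
  define c where "c = 2 * (std_normal_density u * (a + b * u))"
  have c: "0 \<le> c" using ab by (simp add: c_def)
  have [measurable]: "k \<in> borel_measurable borel" by fact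
  have "(\<integral>\<^sup>+z. ennreal (k (v \<bullet> z)) \<partial>std_gaussian) \<le> ennreal c"
  proof (cases "v = 0")
    case True
    then show ?thesis using zero[of 0] u by simp
  next
    case False
    define w where "w = (1 / norm v) *\<^sub>R v"
    have w: "norm w = 1" "w \<noteq> 0" using False by (auto simp: w_def)
    have "\<bar>v \<bullet> z\<bar> \<le> \<bar>w \<bullet> z\<bar>" for z
    proof -
      have "\<bar>v \<bullet> z\<bar> = norm v * \<bar>w \<bullet> z\<bar>" using False by (simp add: w_def)
      also have "\<dots> \<le> 1 * \<bar>w \<bullet> z\<bar>" using v by (intro mult_right_mono) auto
      finally show ?thesis by simp
    qed
    then have "(\<integral>\<^sup>+z. ennreal (k (v \<bullet> z)) \<partial>std_gaussian) \<le> (\<integral>\<^sup>+z. ennreal (k (w \<bullet> z)) \<partial>std_gaussian)"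
      by (intro nn_integral_mono ennreal_leI mono)
    also have "\<dots> = (\<integral>\<^sup>+x. ennreal (std_normal_density x) * ennreal (k x) \<partial>lborel)"
      using distributed_inner_std_gaussian[OF w(2)] w(1) by (subst distributed_nn_integral) auto
    also have "\<dots> = (\<integral>\<^sup>+x. ennreal (std_normal_density x * k x) \<partial>lborel)"
      by (simp add: ennreal_mult' k(2))
    also have "\<dots> \<le> ennreal c"
      unfolding c_def
    proof (rule nn_integral_std_normal_even_tail_le)
      show "k (- x) = k x" for x by (intro antisym mono) auto
      show "0 \<le> x * (a + b * x) - b" if "u \<le> x" for x using le[OF that] k(2)[of x] by linarith
    qed (use k zero u le ab in auto)
    finally show ?thesis .
  qed
  then show int: "integrable std_gaussian (\<lambda>z. k (v \<bullet> z))"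
    using k(2) by (auto simp: integrable_iff_bounded le_less_trans[OF _ ennreal_less_top])
  with \<open>(\<integral>\<^sup>+z. ennreal (k (v \<bullet> z)) \<partial>std_gaussian) \<le> ennreal c\<close>
  show "(\<integral>z. k (v \<bullet> z) \<partial>std_gaussian) \<le> 2 * (std_normal_density u * (a + b * u))"
    using k(2) c by (subst (asm) nn_integral_eq_integral) (auto simp: c_def)
qed

text \<open>With \<open>a = \<alpha> * (1 - u\<^sup>2)\<close> and \<open>b = \<alpha> * u\<close>
  the dominating polynomial is \<open>\<alpha> * (x - u) * (1 + u * x)\<close>, at least
  \<open>x - u\<close> for \<open>x \<ge> u\<close>, while the boundary factor
  \<open>a + b * u\<close> is only \<open>\<alpha>\<close>.\<close>

lemma std_gaussian_expected_excess:
  fixes v :: "'a::euclidean_space"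
  assumes v: "norm v \<le> 1" and u: "0 < u"
  shows "integrable std_gaussian (\<lambda>z. max 0 (\<bar>v \<bullet> z\<bar> - u))"
    and "(\<integral>z. max 0 (\<bar>v \<bullet> z\<bar> - u) \<partial>std_gaussian) \<le> 2 * std_normal_density u / (1 + u\<^sup>2)"
proof -
  define \<alpha> where "\<alpha> = 1 / (1 + u\<^sup>2)"
  have pos: "1 + u\<^sup>2 > 0" by (simp add: add_pos_nonneg)
  have \<alpha>: "\<alpha> > 0" "\<alpha> * (1 + u\<^sup>2) = 1" using pos by (auto simp: \<alpha>_def)
  have le: "max 0 (\<bar>x\<bar> - u) \<le> x * (\<alpha> * (1 - u\<^sup>2) + \<alpha> * u * x) - \<alpha> * u" if "u \<le> x" for x
  proof -
    have "(x - u) * (\<alpha> * (1 + u\<^sup>2)) \<le> (x - u) * (\<alpha> * (1 + u * x))"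
      using that u \<alpha>(1) by (intro mult_left_mono) (auto simp: power2_eq_square)
    then show ?thesis using that u unfolding \<alpha>(2) by (simp add: algebra_simps power2_eq_square)
  qed
  have val: "\<alpha> * (1 - u\<^sup>2) + \<alpha> * u * u = \<alpha>" by (simp add: algebra_simps power2_eq_square)
  show "integrable std_gaussian (\<lambda>z. max 0 (\<bar>v \<bullet> z\<bar> - u))"
    by (rule std_gaussian_even_tail_le(1)[OF v _ _ _ _ u le]) (use u \<alpha> val in auto)
  have "(\<integral>z. max 0 (\<bar>v \<bullet> z\<bar> - u) \<partial>std_gaussian) \<le> 2 * (std_normal_density u * (\<alpha> * (1 - u\<^sup>2) + \<alpha> * u * u))"
    by (rule std_gaussian_even_tail_le(2)[OF v _ _ _ _ u le]) (use u \<alpha> val in auto)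
  then show "(\<integral>z. max 0 (\<bar>v \<bullet> z\<bar> - u) \<partial>std_gaussian) \<le> 2 * std_normal_density u / (1 + u\<^sup>2)"
    unfolding val by (simp add: \<alpha>_def)
qed

text \<open>The Mills ratio bound: on the tail 1 is at most \<open>x / u\<close>, that is
  \<open>a = 1 / u\<close> and \<open>b = 0\<close>.\<close>

lemma std_gaussian_tail:
  fixes v :: "'a::euclidean_space"
  assumes v: "norm v \<le> 1" and u: "0 < u"
  shows "measure std_gaussian {z. u < \<bar>v \<bullet> z\<bar>} \<le> 2 * std_normal_density u / u"
proof -
  let ?k = "indicator {x. u < \<bar>x\<bar>} :: real \<Rightarrow> real"
  have "measure std_gaussian {z. u < \<bar>v \<bullet> z\<bar>} = (\<integral>z. indicator {z. u < \<bar>v \<bullet> z\<bar>} z \<partial>std_gaussian)" by simp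
  also have "\<dots> = (\<integral>z. ?k (v \<bullet> z) \<partial>std_gaussian)" by (intro Bochner_Integration.integral_cong) (auto simp: indicator_def)
  also have "\<dots> \<le> 2 * (std_normal_density u * (1 / u + 0 * u))"
  proof (rule std_gaussian_even_tail_le(2)[OF v])
    show "?k x \<le> x * (1 / u + 0 * x) - 0" if "u \<le> x" for x using that u by (auto simp: indicator_def)
  qed (use u in \<open>auto simp: indicator_def\<close>)
  finally show ?thesis by simp
qed

subsection \<open>The maximum of Gaussian variables\<close>

lemma ln_2_ge: "693 / 1000 \<le> ln (2 :: real)"
  using ln_approx_bounds[of 2 3] by (simp add: eval_nat_numeral)

text \<open>Machin's formula, with \<open>arctan x \<ge> x - x ^ 3 / 3\<close> at 1/5 and
  \<open>arctan x \<le> x\<close> at 1/239. The value 25/8 is the one for which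
  \<open>2 * pi \<ge> (5 / 2)\<^sup>2\<close>.\<close>

lemma pi_ge: "25 / 8 \<le> pi"
proof -
  have "(0::real) \<le> 1 / 5" by simp
  then have "arctan 0 - 0 + 0 ^ 3 / 3 \<le> arctan (1 / 5) - 1 / 5 + (1 / 5) ^ 3 / 3"
  proof (rule DERIV_nonneg_imp_nondecreasing, intro exI conjI)
    fix x :: real
    have "1 + x\<^sup>2 > 0" by (simp add: add_pos_nonneg)
    then have eq: "inverse (1 + x\<^sup>2) - 1 + x\<^sup>2 = x ^ 4 / (1 + x\<^sup>2)"
      by (simp add: field_simps)
    show "((\<lambda>x. arctan x - x + x ^ 3 / 3) has_real_derivative inverse (1 + x\<^sup>2) - 1 + x\<^sup>2) (at x)"
      by (auto intro!: derivative_eq_intros)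
    show "0 \<le> inverse (1 + x\<^sup>2) - 1 + x\<^sup>2" unfolding eq by (intro divide_nonneg_nonneg) auto
  qed
  moreover have "arctan (1 / 239) \<le> 1 / 239" by (rule arctan_le_self) simp
  ultimately show ?thesis using machin by (simp add: eval_nat_numeral)
qed

lemma std_normal_density_le: "std_normal_density x \<le> 2 / 5 * exp (- x\<^sup>2 / 2)"
proof -
  have "sqrt ((5 / 2)\<^sup>2) \<le> sqrt (2 * pi)"
    using pi_ge by (intro real_sqrt_le_mono) (simp add: power2_eq_square)
  then have "5 / 2 \<le> sqrt (2 * pi)" by simp
  then have "1 / sqrt (2 * pi) \<le> 1 / (5 / 2)" by (intro divide_left_mono) auto
  then show ?thesis unfolding std_normal_density_def by (intro mult_right_mono) auto
qed

text \<open>\<open>L\<close> is the level of the union bound, and \<open>u\<close> is the threshold with \<open>p * exp (- u\<^sup>2 / 2) = 2\<close>,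
  which nearly minimises the bound \<open>u + p * E max 0 (\<bar>Z\<bar> - u)\<close> on the expected maximum.\<close>

locale gaussian_levels =
  fixes p L u :: real
  assumes p: "16 \<le> p" and L_def: "L = sqrt (2 * ln p)" and u_def: "u = sqrt (2 * ln (p / 2))"
begin

lemma L_sq: "L\<^sup>2 = 2 * ln p" using p by (simp add: L_def)
lemma u_sq: "u\<^sup>2 = 2 * ln (p / 2)" using p by (simp add: u_def)
lemma L_u: "L\<^sup>2 = u\<^sup>2 + 2 * ln 2" using p by (simp add: L_sq u_sq ln_div)

text \<open>From \<open>p / 2 \<ge> 8\<close> one gets
  \<open>u\<^sup>2 \<ge> 6 * ln 2 \<ge> 4.158\<close>, and 2.0391 lies just below the square root of
  4.158.\<close>

lemma u_ge: "20391 / 10000 \<le> u"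
proof -
  have "ln 8 \<le> ln (p / 2)" using p by (intro ln_mono) auto
  moreover have "ln (8 :: real) = 3 * ln 2" using ln_realpow[of 2 3] by simp
  ultimately have "4158 / 1000 \<le> u\<^sup>2" unfolding u_sq using ln_2_ge by simp
  moreover have "(20391 / 10000 :: real)\<^sup>2 \<le> 4158 / 1000" by (simp add: power2_eq_square)
  ultimately have "(20391 / 10000)\<^sup>2 \<le> u\<^sup>2" by linarith
  moreover have "0 \<le> u" unfolding u_def using p by simp
  ultimately show ?thesis by (rule power2_le_imp_le)
qed

lemma u_le_L: "u \<le> L" using p unfolding u_def L_def by (intro real_sqrt_le_mono) auto

lemma exp_u: "p * exp (- u\<^sup>2 / 2) = 2"
  using p by (simp add: u_sq exp_minus)

lemma exp_L: "p * exp (- L\<^sup>2 / 2) = 1"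
  using p by (simp add: L_sq exp_minus)

lemma exp_2L: "p * exp (- (2 * L)\<^sup>2 / 2) \<le> 1 / 4096"
proof -
  have "p * exp (- (2 * L)\<^sup>2 / 2) = p * exp (- L\<^sup>2 / 2) ^ 4"
    by (simp add: power_mult_distrib exp_of_nat_mult[symmetric])
  also have "exp (- L\<^sup>2 / 2) = 1 / p" using exp_L p by (simp add: field_simps)
  also have "p * (1 / p) ^ 4 = (1 / p) ^ 3" using p by (simp add: eval_nat_numeral)
  also have "\<dots> \<le> (1 / 16) ^ 3" using p by (intro power_mono divide_left_mono) auto
  also have "(1 / 16 :: real) ^ 3 = 1 / 4096" by (simp add: eval_nat_numeral)
  finally show ?thesis .
qed

text \<open>An upper bound for the mean of \<open>excess\<close>: the excesses over \<open>u\<close>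
  contribute \<open>8 / 5 / (1 + u\<^sup>2)\<close>, and the margin up to 1.61 absorbs those over
  \<open>2 * L\<close>.\<close>

definition "w = u + 161 / 100 / (1 + u\<^sup>2)"

text \<open>The definite gain of the expected maximum over the union bound level. The gap
  \<open>L\<^sup>2 - u\<^sup>2 = 2 * ln 2\<close> is at least 1.386, whereas
  \<open>w\<^sup>2 - u\<^sup>2\<close> is a sum of two terms decreasing in \<open>u \<ge> 1\<close>,
  which are evaluated at the lower bound of \<open>u\<close>.\<close>

lemma w_le: "w\<^sup>2 + 1 / 100 \<le> L\<^sup>2"
proof -
  define a :: real where "a = 20391 / 10000"
  have a: "a \<le> u" "1 \<le> a" using u_ge by (auto simp: a_def)
  have pos: "1 + u\<^sup>2 > 0" "1 + a\<^sup>2 > 0" by (auto simp: add_pos_nonneg)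
  have "0 \<le> (u - a) * (u * a - 1)" using a mult_mono[of 1 u 1 a] by (intro mult_nonneg_nonneg) auto
  then have "u * (1 + a\<^sup>2) \<le> a * (1 + u\<^sup>2)" by (simp add: algebra_simps power2_eq_square)
  then have 1: "u / (1 + u\<^sup>2) \<le> a / (1 + a\<^sup>2)" using pos by (simp add: field_simps)
  have "1 + a\<^sup>2 \<le> 1 + u\<^sup>2" using a by (intro add_left_mono power_mono) auto
  then have 2: "1 / (1 + u\<^sup>2) \<le> 1 / (1 + a\<^sup>2)" using pos by (intro divide_left_mono) auto
  have "w\<^sup>2 = u\<^sup>2 + 322 / 100 * (u / (1 + u\<^sup>2)) + (161 / 100)\<^sup>2 * (1 / (1 + u\<^sup>2))\<^sup>2"
  proof -
    define c where "c = 1 / (1 + u\<^sup>2)"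
    have "w = u + 161 / 100 * c" "u / (1 + u\<^sup>2) = u * c" by (simp_all add: w_def c_def)
    then show ?thesis unfolding c_def[symmetric] by (simp add: power2_eq_square algebra_simps)
  qed
  also have "\<dots> \<le> u\<^sup>2 + 322 / 100 * (a / (1 + a\<^sup>2)) + (161 / 100)\<^sup>2 * (1 / (1 + a\<^sup>2))\<^sup>2"
    using pos a by (intro add_mono mult_left_mono power_mono 1 2) auto
  also have "322 / 100 * (a / (1 + a\<^sup>2)) + (161 / 100)\<^sup>2 * (1 / (1 + a\<^sup>2))\<^sup>2 + 1 / 100 \<le> 1386 / 1000"
    by (simp add: a_def power2_eq_square)
  then have "u\<^sup>2 + 322 / 100 * (a / (1 + a\<^sup>2)) + (161 / 100)\<^sup>2 * (1 / (1 + a\<^sup>2))\<^sup>2 \<le> L\<^sup>2 - 1 / 100"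
    using ln_2_ge by (simp add: L_u)
  finally show ?thesis by simp
qed

lemma L_ge: "2 \<le> L" and L_pos: "0 < L" and u_pos: "0 < u"
  using u_ge u_le_L by linarith+

lemma w_le_L: "w \<le> L"
  using w_le L_pos by (intro power2_le_imp_le[of w L]) auto

text \<open>An integrable majorant of \<open>c + 3 * max 0 (c - 2 * L)\<close> for the maximum
  \<open>c\<close>, with sums in place of maxima so that the mean splits. The last term pays for
  noise above the penalty level; its 3 is the cone constant.\<close>

definition excess :: "('p \<Rightarrow> 'a::euclidean_space) \<Rightarrow> 'a \<Rightarrow> real" where
  "excess x a = u + (\<Sum>j\<in>UNIV. max 0 (\<bar>x j \<bullet> a\<bar> - u)) + 3 * (\<Sum>j\<in>UNIV. max 0 (\<bar>x j \<bullet> a\<bar> - 2 * L))"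

lemma excess_nonneg: "0 \<le> excess x a"
  unfolding excess_def using u_pos by (intro add_nonneg_nonneg mult_nonneg_nonneg sum_nonneg) auto

lemma le_excess:
  fixes x :: "'p::finite \<Rightarrow> 'a::euclidean_space"
  assumes "c = (MAX j. \<bar>x j \<bullet> a\<bar>)"
  shows "c + 3 * max 0 (c - 2 * L) \<le> excess x a"
proof -
  have "(MAX j. \<bar>x j \<bullet> a\<bar>) \<in> range (\<lambda>j. \<bar>x j \<bullet> a\<bar>)" by (rule Max_in) auto
  then obtain j where j: "c = \<bar>x j \<bullet> a\<bar>" unfolding assms by (rule imageE)
  define E where "E r = (\<Sum>j\<in>UNIV. max 0 (\<bar>x j \<bullet> a\<bar> - r))" for r
  have s: "max 0 (c - r) \<le> E r" for r
    unfolding j E_def by (rule member_le_sum) auto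
  have "c \<le> u + E u" using s[of u] by simp
  then show ?thesis unfolding excess_def E_def[symmetric] by (intro add_mono mult_left_mono s) auto
qed

lemma
  fixes x :: "'p::finite \<Rightarrow> 'a::euclidean_space"
  assumes x: "\<And>j. norm (x j) \<le> 1" and card: "p = real CARD('p)"
  shows integrable_excess: "integrable std_gaussian (excess x)"
    and expectation_excess: "(\<integral>a. excess x a \<partial>std_gaussian) \<le> w"
    and union_bound: "measure std_gaussian {a. \<exists>j. L < \<bar>x j \<bullet> a\<bar>} \<le> 2 / 5"
proof -
  interpret prob_space "std_gaussian :: 'a measure" by (rule prob_space_std_gaussian)
  note exc = std_gaussian_expected_excess[OF x]
  have i: "integrable std_gaussian (\<lambda>a. \<Sum>j\<in>UNIV. max 0 (\<bar>x j \<bullet> a\<bar> - r))" if "0 < r" for r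
    by (intro Bochner_Integration.integrable_sum exc that)
  have e: "(\<integral>a. (\<Sum>j\<in>UNIV. max 0 (\<bar>x j \<bullet> a\<bar> - r)) \<partial>std_gaussian) \<le> 4 / 5 * (p * exp (- r\<^sup>2 / 2)) / (1 + r\<^sup>2)"
    if r: "0 < r" for r
  proof -
    have "(\<integral>a. (\<Sum>j\<in>UNIV. max 0 (\<bar>x j \<bullet> a\<bar> - r)) \<partial>std_gaussian)
      = (\<Sum>j\<in>UNIV. (\<integral>a. max 0 (\<bar>x j \<bullet> a\<bar> - r) \<partial>std_gaussian))"
      by (intro Bochner_Integration.integral_sum exc r)
    also have "\<dots> \<le> (\<Sum>j\<in>(UNIV :: 'p set). 2 * (2 / 5 * exp (- r\<^sup>2 / 2)) / (1 + r\<^sup>2))"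
      by (intro sum_mono order.trans[OF exc(2)] r divide_right_mono mult_left_mono std_normal_density_le) auto
    finally show ?thesis by (simp add: card mult_ac)
  qed
  show int: "integrable std_gaussian (excess x)"
    unfolding excess_def using i[of u] i[of "2 * L"] u_pos L_pos by auto
  have "(\<integral>a. excess x a \<partial>std_gaussian) = u + (\<integral>a. (\<Sum>j\<in>UNIV. max 0 (\<bar>x j \<bullet> a\<bar> - u)) \<partial>std_gaussian)
      + 3 * (\<integral>a. (\<Sum>j\<in>UNIV. max 0 (\<bar>x j \<bullet> a\<bar> - 2 * L)) \<partial>std_gaussian)"
    unfolding excess_def using i[of u] i[of "2 * L"] u_pos L_pos prob_space by simp
  also have "\<dots> \<le> u + 4 / 5 * (p * exp (- u\<^sup>2 / 2)) / (1 + u\<^sup>2) + 3 * (4 / 5 * (p * exp (- (2 * L)\<^sup>2 / 2)) / (1 + (2 * L)\<^sup>2))"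
    using u_pos L_pos by (intro add_mono mult_left_mono e) auto
  \<comment> \<open>Weakening \<open>1 + (2 * L)\<^sup>2\<close> to \<open>1 + u\<^sup>2\<close>
    lets the two contributions be merged.\<close>
  also have "\<dots> \<le> u + 4 / 5 * 2 / (1 + u\<^sup>2) + 3 * (4 / 5 * (1 / 4096) / (1 + u\<^sup>2))"
  proof -
    have "u\<^sup>2 \<le> (2 * L)\<^sup>2" using u_pos u_le_L by (intro power_mono) auto
    then have *: "4 / 5 * (p * exp (- (2 * L)\<^sup>2 / 2)) / (1 + (2 * L)\<^sup>2) \<le> 4 / 5 * (1 / 4096) / (1 + u\<^sup>2)"
      by (intro frac_le mult_left_mono exp_2L) (auto simp: add_pos_nonneg)
    show ?thesis unfolding exp_u by (intro add_mono mult_left_mono order.refl *) simp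
  qed
  also have "\<dots> = u + (8 / 5 + 12 / 5 / 4096) * (1 / (1 + u\<^sup>2))"
  proof -
    have "u + 4 / 5 * 2 / q + 3 * (4 / 5 * (1 / 4096) / q) = u + (8 / 5 + 12 / 5 / 4096) * (1 / q)" for q
      by (cases "q = 0") (auto simp: field_simps)
    then show ?thesis .
  qed
  also have "\<dots> \<le> u + 161 / 100 * (1 / (1 + u\<^sup>2))" by (intro add_mono mult_right_mono) auto
  finally show "(\<integral>a. excess x a \<partial>std_gaussian) \<le> w" by (simp add: w_def)
  have "measure std_gaussian {a. \<exists>j. L < \<bar>x j \<bullet> a\<bar>} = measure std_gaussian (\<Union>j\<in>UNIV. {a. L < \<bar>x j \<bullet> a\<bar>})"
    by (intro arg_cong[where f="measure _"]) auto
  also have "\<dots> \<le> (\<Sum>j\<in>(UNIV :: 'p set). measure std_gaussian {a. L < \<bar>x j \<bullet> a\<bar>})"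
    by (intro finite_measure_subadditive_finite) auto
  also have "\<dots> \<le> (\<Sum>j\<in>(UNIV :: 'p set). 2 * (2 / 5 * exp (- L\<^sup>2 / 2)) / 2)"
    using L_ge L_pos by (intro sum_mono order.trans[OF std_gaussian_tail[OF x L_pos]] frac_le mult_left_mono std_normal_density_le) auto
  also have "\<dots> = 2 / 5 * (p * exp (- L\<^sup>2 / 2))" by (simp add: card)
  also have "\<dots> = 2 / 5" unfolding exp_L by simp
  finally show "measure std_gaussian {a. \<exists>j. L < \<bar>x j \<bullet> a\<bar>} \<le> 2 / 5" .
qed

text \<open>The gain in \<open>w_le\<close> improves the first exponent by at least 1/50, so the
  first term uses at most 50/51 of the target. The second exponent exceeds
  \<open>t\<^sup>2 / 2\<close> by more than 16 because \<open>t\<^sup>2 \<ge> 64\<close>, and fits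
  into the remaining 1/51.\<close>

lemma exponent_slack:
  assumes t: "4 * L \<le> t"
  shows "exp (- (t * (5 / 4 - w / (4 * L)))\<^sup>2 / 2) + exp (- (3 / 5 * ((7 / 4 * t)\<^sup>2 / 2))) \<le> exp (- t\<^sup>2 / 2)"
proof -
  \<comment> \<open>The relative gain: \<open>5 / 4 - w / (4 * L) = 1 + d\<close>.\<close>
  define d where "d = (L - w) / (4 * L)"
  have d: "0 \<le> d" using w_le_L L_pos by (simp add: d_def)
  have t2: "16 * L\<^sup>2 \<le> t\<^sup>2" using power_mono[OF t, of 2] L_pos by (simp add: power_mult_distrib)
  have "1 / 100 \<le> L\<^sup>2 - w\<^sup>2" using w_le by simp
  also have "\<dots> = (L - w) * (L + w)" by (simp add: algebra_simps power2_eq_square)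
  also have "\<dots> \<le> (L - w) * (2 * L)" using w_le_L by (intro mult_left_mono) auto
  also have "\<dots> = 8 * L\<^sup>2 * d" using L_pos by (simp add: d_def power2_eq_square)
  finally have *: "1 / 50 \<le> 16 * L\<^sup>2 * d" by simp
  also have "\<dots> \<le> t\<^sup>2 * d" using t2 d by (intro mult_right_mono)
  finally have td: "1 / 50 \<le> t\<^sup>2 * d" .
  have tq: "t * (5 / 4 - w / (4 * L)) = t * (1 + d)" using L_pos by (simp add: d_def field_simps)
  have "(t * (1 + d))\<^sup>2 = t\<^sup>2 + 2 * (t\<^sup>2 * d) + (t * d)\<^sup>2" by (simp add: power2_eq_square algebra_simps)
  then have "t\<^sup>2 + 2 * (t\<^sup>2 * d) \<le> (t * (1 + d))\<^sup>2" by simp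
  then have "exp (- (t * (5 / 4 - w / (4 * L)))\<^sup>2 / 2) \<le> exp (- t\<^sup>2 / 2 - 1 / 50)"
    unfolding tq using td by simp
  also have "\<dots> = exp (- t\<^sup>2 / 2) * exp (- (1 / 50))" by (simp only: exp_add diff_conv_add_uminus)
  also have "\<dots> \<le> exp (- t\<^sup>2 / 2) * (50 / 51)"
    using exp_ge_add_one_self[of "1 / 50 :: real"] by (intro mult_left_mono) (auto simp: exp_minus field_simps)
  finally have 1: "exp (- (t * (5 / 4 - w / (4 * L)))\<^sup>2 / 2) \<le> exp (- t\<^sup>2 / 2) * (50 / 51)" .
  have "64 \<le> t\<^sup>2" using t2 power_mono[OF L_ge, of 2] by simp
  then have "exp (- (3 / 5 * ((7 / 4 * t)\<^sup>2 / 2))) \<le> exp (- t\<^sup>2 / 2 - 16)" by (simp add: power_mult_distrib power_divide)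
  also have "\<dots> = exp (- t\<^sup>2 / 2) * exp (- 16)" by (simp only: exp_add diff_conv_add_uminus)
  also have "\<dots> = exp (- t\<^sup>2 / 2) * exp (- 1) ^ 16" using exp_of_nat_mult[of 16 "- 1 :: real"] by simp
  also have "\<dots> \<le> exp (- t\<^sup>2 / 2) * (1 / 2) ^ 16"
    using exp_ge_add_one_self[of "1 :: real"] by (intro mult_left_mono power_mono) (auto simp: exp_minus field_simps)
  also have "(1 / 2 :: real) ^ 16 = 1 / 65536" by (simp add: power_one_over)
  finally have 2: "exp (- (3 / 5 * ((7 / 4 * t)\<^sup>2 / 2))) \<le> exp (- t\<^sup>2 / 2) * (1 / 65536)" .
  have "exp (- t\<^sup>2 / 2) * (50 / 51) + exp (- t\<^sup>2 / 2) * (1 / 65536) \<le> exp (- t\<^sup>2 / 2)" by simp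
  with 1 2 show ?thesis by linarith
qed

end

subsection \<open>Gaussian projections\<close>

lemma nn_integral_exp_std_normal:
  "(\<integral>\<^sup>+x. ennreal (exp (b * x)) \<partial>std_normal_distribution) = ennreal (exp (b\<^sup>2 / 2))"
proof -
  have "(\<integral>\<^sup>+x. ennreal (exp (b * x)) \<partial>std_normal_distribution)
      = (\<integral>\<^sup>+x. ennreal (std_normal_density x) * ennreal (exp (b * x)) \<partial>lborel)"
    by (subst nn_integral_density) auto
  also have "\<dots> = (\<integral>\<^sup>+x. ennreal (exp (b\<^sup>2 / 2)) * ennreal (normal_density b 1 x) \<partial>lborel)"
  proof (intro nn_integral_cong)
    fix x
    have "std_normal_density x * exp (b * x) = exp (b\<^sup>2 / 2) * normal_density b 1 x"
    proof -
      have "exp (- x\<^sup>2 / 2) * exp (b * x) = exp (b\<^sup>2 / 2) * exp (- (x - b)\<^sup>2 / 2)"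
        unfolding exp_add[symmetric] by (rule arg_cong[where f=exp]) (simp add: power2_eq_square field_simps)
      then show ?thesis by (simp add: normal_density_def)
    qed
    then show "ennreal (std_normal_density x) * ennreal (exp (b * x)) = ennreal (exp (b\<^sup>2 / 2)) * ennreal (normal_density b 1 x)"
      by (simp add: ennreal_mult[symmetric])
  qed
  also have "\<dots> = ennreal (exp (b\<^sup>2 / 2)) * (\<integral>\<^sup>+x. ennreal (normal_density b 1 x) \<partial>lborel)"
    by (rule nn_integral_cmult) simp
  also have "(\<integral>\<^sup>+x. ennreal (normal_density b 1 x) \<partial>lborel) = 1"
    by (subst nn_integral_eq_integral) auto
  finally show ?thesis by simp
qed

text \<open>The weight turns the standard normal density into the centred normal density of variance
  \<open>1 / (1 - \<theta>)\<close>, up to the factor \<open>r\<close>.\<close>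

lemma nn_integral_exp_square_std_normal:
  assumes th: "\<theta> < 1"
  shows "(\<integral>\<^sup>+x. ennreal (exp (\<theta> * x\<^sup>2 / 2)) \<partial>std_normal_distribution) = ennreal (1 / sqrt (1 - \<theta>))"
proof -
  define r where "r = 1 / sqrt (1 - \<theta>)"
  have r: "r > 0" "r\<^sup>2 * (1 - \<theta>) = 1" using th by (auto simp: r_def power_divide)
  have "(\<integral>\<^sup>+x. ennreal (exp (\<theta> * x\<^sup>2 / 2)) \<partial>std_normal_distribution)
      = (\<integral>\<^sup>+x. ennreal (std_normal_density x) * ennreal (exp (\<theta> * x\<^sup>2 / 2)) \<partial>lborel)"
    by (subst nn_integral_density) auto
  also have "\<dots> = (\<integral>\<^sup>+x. ennreal r * ennreal (normal_density 0 r x) \<partial>lborel)"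
  proof (intro nn_integral_cong)
    fix x
    have "1 / r\<^sup>2 = 1 - \<theta>" using r by (simp add: field_simps)
    moreover have "- (x\<^sup>2 / (2 * r\<^sup>2)) = - (x\<^sup>2 / 2 * (1 / r\<^sup>2))" by simp
    ultimately have "- (x\<^sup>2 / (2 * r\<^sup>2)) = - (x\<^sup>2 / 2 * (1 - \<theta>))" by simp
    also have "\<dots> = - x\<^sup>2 / 2 + \<theta> * x\<^sup>2 / 2" by (simp add: field_simps)
    finally have "- (x\<^sup>2 / (2 * r\<^sup>2)) = - x\<^sup>2 / 2 + \<theta> * x\<^sup>2 / 2" .
    then have "exp (- (x\<^sup>2 / (2 * r\<^sup>2))) = exp (- x\<^sup>2 / 2) * exp (\<theta> * x\<^sup>2 / 2)" by (simp only: exp_add)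
    then have "std_normal_density x * exp (\<theta> * x\<^sup>2 / 2) = r * normal_density 0 r x"
      using r by (simp add: normal_density_def real_sqrt_mult)
    then show "ennreal (std_normal_density x) * ennreal (exp (\<theta> * x\<^sup>2 / 2)) = ennreal r * ennreal (normal_density 0 r x)"
      using r by (simp add: ennreal_mult[symmetric])
  qed
  also have "\<dots> = ennreal r * (\<integral>\<^sup>+x. ennreal (normal_density 0 r x) \<partial>lborel)"
    by (rule nn_integral_cmult) simp
  also have "(\<integral>\<^sup>+x. ennreal (normal_density 0 r x) \<partial>lborel) = 1"
    using r by (subst nn_integral_eq_integral) auto
  finally show ?thesis by (simp add: r_def)
qed

lemma nn_integral_PiM_std_normal_prod:
  assumes "finite I" "\<And>i. i \<in> I \<Longrightarrow> f i \<in> borel_measurable borel"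
  shows "(\<integral>\<^sup>+x. (\<Prod>i\<in>I. f i (x i)) \<partial>PiM I (\<lambda>_. std_normal_distribution))
    = (\<Prod>i\<in>I. \<integral>\<^sup>+x. f i x \<partial>std_normal_distribution)"
proof -
  interpret N: prob_space std_normal_distribution using prob_space_normal_density by simp
  interpret PP: product_prob_space "\<lambda>_. std_normal_distribution" I ..
  show ?thesis using assms by (intro PP.product_nn_integral_prod) auto
qed

lemma nn_integral_exp_inner_std_gaussian:
  fixes v :: "'a::euclidean_space"
  shows "(\<integral>\<^sup>+z. ennreal (exp (v \<bullet> z)) \<partial>std_gaussian) = ennreal (exp (v \<bullet> v / 2))"
proof -
  note [measurable] = measurable_from_coordinates[where 'a='a]
  have "(\<integral>\<^sup>+z. ennreal (exp (v \<bullet> z)) \<partial>std_gaussian)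
     = (\<integral>\<^sup>+f. (\<Prod>b\<in>Basis. ennreal (exp ((v \<bullet> b) * f b))) \<partial>PiM Basis (\<lambda>_. std_normal_distribution))"
    unfolding std_gaussian_def
    by (subst nn_integral_distr)
       (auto simp: inner_sum_right exp_sum prod_ennreal mult.commute intro!: nn_integral_cong)
  also have "\<dots> = (\<Prod>b\<in>Basis. \<integral>\<^sup>+x. ennreal (exp ((v \<bullet> b) * x)) \<partial>std_normal_distribution)"
    by (rule nn_integral_PiM_std_normal_prod) auto
  also have "\<dots> = ennreal (\<Prod>b\<in>Basis. exp ((v \<bullet> b)\<^sup>2 / 2))"
    by (simp add: nn_integral_exp_std_normal prod_ennreal)
  also have "(\<Prod>b\<in>Basis. exp ((v \<bullet> b)\<^sup>2 / 2)) = exp (v \<bullet> v / 2)"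
    by (simp add: exp_sum[symmetric] euclidean_inner[of v v] power2_eq_square sum_divide_distrib)
  finally show ?thesis .
qed

text \<open>Writing \<open>exp (\<theta> * y\<^sup>2 / 2)\<close> as a Gaussian average of \<open>exp (sqrt \<theta> * g * y)\<close> makes the exponent
  linear in \<open>z\<close>, which avoids rotating the coordinates.\<close>

lemma nn_integral_exp_square_proj:
  fixes E :: "'a::euclidean_space set"
  assumes E: "finite E" "pairwise orthogonal E" "\<And>e. e \<in> E \<Longrightarrow> norm e = 1" and th: "0 \<le> \<theta>" "\<theta> < 1"
  shows "(\<integral>\<^sup>+z. ennreal (exp (\<theta> * (\<Sum>e\<in>E. (e \<bullet> z)\<^sup>2) / 2)) \<partial>std_gaussian) = ennreal ((1 / sqrt (1 - \<theta>)) ^ card E)"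
proof -
  let ?Q = "PiM E (\<lambda>_. std_normal_distribution)"
  interpret G: prob_space "std_gaussian :: 'a measure" by (rule prob_space_std_gaussian)
  interpret N: prob_space std_normal_distribution using prob_space_normal_density by simp
  interpret Q: prob_space ?Q by (rule prob_space_PiM) (rule N.prob_space_axioms)
  interpret GQ: pair_sigma_finite "std_gaussian :: 'a measure" ?Q ..
  define v where "v g = (\<Sum>e\<in>E. (sqrt \<theta> * g e) *\<^sub>R e)" for g :: "'a \<Rightarrow> real"
  have vz: "v g \<bullet> z = (\<Sum>e\<in>E. sqrt \<theta> * (e \<bullet> z) * g e)" for g z
    unfolding v_def inner_sum_left by (intro sum.cong) auto
  have ev: "e \<bullet> v g = sqrt \<theta> * g e" if "e \<in> E" for e g
  proof -
    have "e \<bullet> v g = (\<Sum>e'\<in>E. (sqrt \<theta> * g e') * (e \<bullet> e'))" by (simp add: v_def inner_sum_right)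
    also have "\<dots> = (\<Sum>e'\<in>E. if e' = e then sqrt \<theta> * g e else 0)"
      using E(2,3) that by (intro sum.cong) (auto simp: pairwise_def orthogonal_def norm_eq_1)
    finally show ?thesis using E(1) that by simp
  qed
  have vv: "v g \<bullet> v g = \<theta> * (\<Sum>e\<in>E. (g e)\<^sup>2)" for g
    unfolding vz using th by (simp add: ev sum_distrib_left power2_eq_square cong: sum.cong)
       (intro sum.cong, auto simp: mult_ac)
  have vm: "v \<in> borel_measurable ?Q"
    unfolding v_def
  proof (intro borel_measurable_sum borel_measurable_scaleR borel_measurable_times)
    fix e assume "e \<in> E"
    then show "(\<lambda>g. g e) \<in> borel_measurable ?Q"
      using measurable_component_singleton[of e E "\<lambda>_. std_normal_distribution"] by simp
  qed auto
  have "(\<integral>\<^sup>+z. ennreal (exp (\<theta> * (\<Sum>e\<in>E. (e \<bullet> z)\<^sup>2) / 2)) \<partial>std_gaussian)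
     = (\<integral>\<^sup>+z. (\<integral>\<^sup>+g. ennreal (exp (v g \<bullet> z)) \<partial>?Q) \<partial>std_gaussian)"
  proof (intro nn_integral_cong)
    fix z :: 'a
    have "(\<integral>\<^sup>+g. ennreal (exp (v g \<bullet> z)) \<partial>?Q) = (\<integral>\<^sup>+g. (\<Prod>e\<in>E. ennreal (exp (sqrt \<theta> * (e \<bullet> z) * g e))) \<partial>?Q)"
      unfolding vz by (simp add: exp_sum[OF E(1)] prod_ennreal)
    also have "\<dots> = (\<Prod>e\<in>E. ennreal (exp ((sqrt \<theta> * (e \<bullet> z))\<^sup>2 / 2)))"
      by (subst nn_integral_PiM_std_normal_prod[OF E(1)]) (auto simp: nn_integral_exp_std_normal)
    also have "\<dots> = ennreal (exp (\<theta> * (\<Sum>e\<in>E. (e \<bullet> z)\<^sup>2) / 2))"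
      using th by (simp add: prod_ennreal exp_sum[OF E(1), symmetric] power_mult_distrib sum_distrib_left sum_divide_distrib)
    finally show "ennreal (exp (\<theta> * (\<Sum>e\<in>E. (e \<bullet> z)\<^sup>2) / 2)) = (\<integral>\<^sup>+g. ennreal (exp (v g \<bullet> z)) \<partial>?Q)" by simp
  qed
  also have "\<dots> = (\<integral>\<^sup>+g. (\<integral>\<^sup>+z. ennreal (exp (v g \<bullet> z)) \<partial>std_gaussian) \<partial>?Q)"
    using vm by (intro GQ.Fubini'[symmetric]) (simp add: case_prod_beta)
  also have "\<dots> = (\<integral>\<^sup>+g. (\<Prod>e\<in>E. ennreal (exp (\<theta> * (g e)\<^sup>2 / 2))) \<partial>?Q)"
    unfolding nn_integral_exp_inner_std_gaussian vv
    by (simp add: prod_ennreal exp_sum[OF E(1), symmetric] sum_distrib_left sum_divide_distrib)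
  also have "\<dots> = (\<Prod>e\<in>E. ennreal (1 / sqrt (1 - \<theta>)))"
    using th by (subst nn_integral_PiM_std_normal_prod[OF E(1)]) (auto simp: nn_integral_exp_square_std_normal)
  also have "\<dots> = ennreal ((1 / sqrt (1 - \<theta>)) ^ card E)"
    using th by (simp add: ennreal_power)
  finally show ?thesis .
qed

text \<open>The Chernoff bound for a chi-square variable with \<open>card E\<close> degrees of
  freedom; \<open>\<theta>\<close> is left free for later choice.\<close>

lemma std_gaussian_proj_tail:
  fixes E :: "'a::euclidean_space set"
  assumes E: "finite E" "pairwise orthogonal E" "\<And>e. e \<in> E \<Longrightarrow> norm e = 1" and th: "0 \<le> \<theta>" "\<theta> < 1"
  shows "measure std_gaussian {z. r \<le> (\<Sum>e\<in>E. (e \<bullet> z)\<^sup>2)} \<le> exp (- (\<theta> * r / 2)) * (1 / sqrt (1 - \<theta>)) ^ card E"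
proof -
  interpret prob_space "std_gaussian :: 'a measure" by (rule prob_space_std_gaussian)
  let ?S = "\<lambda>z. \<Sum>e\<in>E. (e \<bullet> z)\<^sup>2"
  have "emeasure std_gaussian {z. r \<le> ?S z} = (\<integral>\<^sup>+z. indicator {z. r \<le> ?S z} z \<partial>std_gaussian)"
    by simp
  also have "\<dots> \<le> (\<integral>\<^sup>+z. ennreal (exp (- (\<theta> * r / 2))) * ennreal (exp (\<theta> * ?S z / 2)) \<partial>std_gaussian)"
  proof (intro nn_integral_mono)
    fix z
    show "indicator {z. r \<le> ?S z} z \<le> ennreal (exp (- (\<theta> * r / 2))) * ennreal (exp (\<theta> * ?S z / 2))"
    proof (cases "r \<le> ?S z")
      case True
      then have "\<theta> * r \<le> \<theta> * ?S z" using th by (intro mult_left_mono)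
      then have "1 \<le> exp (- (\<theta> * r / 2)) * exp (\<theta> * ?S z / 2)" by (simp add: exp_add[symmetric])
      then show ?thesis using True by (simp add: ennreal_mult[symmetric])
    qed simp
  qed
  also have "\<dots> = ennreal (exp (- (\<theta> * r / 2))) * ennreal ((1 / sqrt (1 - \<theta>)) ^ card E)"
    by (simp add: nn_integral_cmult nn_integral_exp_square_proj[OF E th])
  also have "\<dots> = ennreal (exp (- (\<theta> * r / 2)) * (1 / sqrt (1 - \<theta>)) ^ card E)"
    using th by (simp add: ennreal_mult)
  finally show ?thesis using th by (simp add: emeasure_eq_measure)
qed

subsection \<open>The noise event\<close>

lemma l1_norm_restrict_vec: "l1_norm (restrict_vec \<Delta> S) = (\<Sum>j\<in>S. \<bar>\<Delta> $ j\<bar>)"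
  unfolding l1_norm_def restrict_vec_def by (rule sum.mono_neutral_cong_right) auto

lemma l1_norm_split: "l1_norm \<Delta> = l1_norm (restrict_vec \<Delta> S) + l1_norm (restrict_vec \<Delta> (- S))"
proof -
  have "sum (\<lambda>j. \<bar>\<Delta> $ j\<bar>) UNIV = sum (\<lambda>j. \<bar>\<Delta> $ j\<bar>) S + sum (\<lambda>j. \<bar>\<Delta> $ j\<bar>) (- S)"
    by (subst sum.union_disjoint[symmetric]) auto
  then show ?thesis unfolding l1_norm_restrict_vec by (simp add: l1_norm_def)
qed

lemma l1_norm_nonneg: "0 \<le> l1_norm u"
  by (simp add: l1_norm_def sum_nonneg)

lemma l1_norm_restrict_vec_le: "l1_norm (restrict_vec \<Delta> S) \<le> sqrt (card S) * norm \<Delta>"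
proof -
  have "(\<Sum>j\<in>S. \<bar>\<Delta> $ j\<bar>) = (\<Sum>j\<in>S. \<bar>1\<bar> * \<bar>\<Delta> $ j\<bar>)" by simp
  also have "\<dots> \<le> L2_set (\<lambda>_. 1) S * L2_set (\<lambda>j. \<Delta> $ j) S" by (rule L2_set_mult_ineq)
  also have "\<dots> \<le> sqrt (card S) * L2_set (\<lambda>j. \<Delta> $ j) UNIV"
    unfolding L2_set_def by (intro mult_mono real_sqrt_le_mono sum_mono2) (auto intro: sum_nonneg)
  also have "L2_set (\<lambda>j. \<Delta> $ j) UNIV = norm \<Delta>" by (simp add: norm_vec_def L2_set_def)
  finally show ?thesis unfolding l1_norm_restrict_vec .
qed

lemma inner_matrix_vector_le:
  fixes Y :: "real ^ 'p ^ 'n"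
  assumes "\<And>j. \<bar>column j Y \<bullet> z\<bar> \<le> c"
  shows "z \<bullet> (Y *v \<Delta>) \<le> c * l1_norm \<Delta>"
proof -
  have "z \<bullet> (Y *v \<Delta>) = (\<Sum>j\<in>UNIV. \<Delta> $ j * (column j Y \<bullet> z))"
    by (simp add: matrix_mult_sum inner_sum_right scalar_mult_eq_scaleR inner_commute)
  also have "\<dots> \<le> (\<Sum>j\<in>UNIV. \<bar>\<Delta> $ j\<bar> * c)"
  proof (intro sum_mono)
    fix j
    have "\<Delta> $ j * (column j Y \<bullet> z) \<le> \<bar>\<Delta> $ j\<bar> * \<bar>column j Y \<bullet> z\<bar>"
      by (metis abs_ge_self abs_mult)
    also have "\<dots> \<le> \<bar>\<Delta> $ j\<bar> * c" by (intro mult_left_mono assms) auto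
    finally show "\<Delta> $ j * (column j Y \<bullet> z) \<le> \<bar>\<Delta> $ j\<bar> * c" .
  qed
  finally show ?thesis by (simp add: l1_norm_def sum_distrib_left mult.commute)
qed

text \<open>Only the projection of \<open>z\<close> onto the span matters: expand \<open>v\<close>
  in the orthonormal family and apply Cauchy-Schwarz to the coefficients.\<close>

lemma inner_span_le:
  fixes E :: "'a::euclidean_space set"
  assumes E: "finite E" "pairwise orthogonal E" "\<And>e. e \<in> E \<Longrightarrow> norm e = 1" and v: "v \<in> span E"
  shows "z \<bullet> v \<le> sqrt (\<Sum>e\<in>E. (e \<bullet> z)\<^sup>2) * norm v"
proof -
  obtain c where c: "v = (\<Sum>e\<in>E. c e *\<^sub>R e)" using v by (auto simp: span_finite[OF E(1)])
  have ev: "e \<bullet> v = c e" if "e \<in> E" for e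
  proof -
    have "e \<bullet> v = (\<Sum>e'\<in>E. c e' * (e \<bullet> e'))" by (simp add: c inner_sum_right)
    also have "\<dots> = (\<Sum>e'\<in>E. if e' = e then c e else 0)"
      using E(2,3) that by (intro sum.cong) (auto simp: pairwise_def orthogonal_def norm_eq_1)
    finally show ?thesis using E(1) that by simp
  qed
  have wv: "w \<bullet> v = (\<Sum>e\<in>E. c e * (e \<bullet> w))" for w
    by (simp add: c inner_sum_right inner_commute)
  have "v \<bullet> v = (\<Sum>e\<in>E. (c e)\<^sup>2)" by (subst wv, intro sum.cong) (auto simp: ev power2_eq_square)
  then have nv: "norm v = L2_set c E" by (simp add: norm_eq_sqrt_inner L2_set_def)
  have "z \<bullet> v \<le> (\<Sum>e\<in>E. \<bar>e \<bullet> z\<bar> * \<bar>c e\<bar>)"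
    unfolding wv by (intro sum_mono) (metis abs_ge_self abs_mult mult.commute)
  also have "\<dots> \<le> L2_set (\<lambda>e. e \<bullet> z) E * L2_set c E" by (rule L2_set_mult_ineq)
  finally show ?thesis by (simp add: nv L2_set_def)
qed

text \<open>The problem rescaled to unit noise variance, with the factor \<open>1 / sqrt n\<close>
  absorbed into the design. \<open>t\<close> makes the target probability
  \<open>exp (- t\<^sup>2 / 2)\<close>, and \<open>t / (2 * lam)\<close> is the constant comparing
  the l1 norm on \<open>S\<close> with the fit inside the cone.\<close>

locale restricted_eigenvalue =
  fixes Y :: "real ^ 'p ^ 'n" and S :: "'p set" and \<kappa> lam t :: real
  assumes col: "\<And>j. norm (column j Y) \<le> 1"
    and S: "S \<noteq> {}" and \<kappa>: "0 < \<kappa>"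
    and RE: "\<And>\<Delta>. \<Delta> \<in> RE_cone S 3 \<Longrightarrow> \<kappa> * norm \<Delta> \<le> norm (Y *v \<Delta>)"
    and card: "2 \<le> CARD('p)"
    and lam: "2 * sqrt (2 * ln (real CARD('p))) \<le> lam"
    and t_def: "t = 2 * lam * sqrt (card S) / \<kappa>"
begin

text \<open>For \<open>\<Delta> = b - \<beta>\<close> with \<open>\<beta>\<close> supported on
  \<open>S\<close> this dominates \<open>l1_norm \<beta> - l1_norm b\<close>, the penalty part of
  the first order condition.\<close>

definition excess_penalty :: "real ^ 'p \<Rightarrow> real" where
  "excess_penalty \<Delta> = l1_norm (restrict_vec \<Delta> S) - l1_norm (restrict_vec \<Delta> (- S))"

text \<open>The noise vectors for which some direction in \<open>C\<close> defeats the oracle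
  argument. Strict inequality makes the set open; the parameter \<open>C\<close> separates the cone
  from its complement.\<close>

definition bad :: "(real ^ 'p) set \<Rightarrow> real \<Rightarrow> (real ^ 'n) set" where
  "bad C r = {z. \<exists>\<Delta>\<in>C. r * norm (Y *v \<Delta>) < z \<bullet> (Y *v \<Delta>) + lam * excess_penalty \<Delta>}"

lemma bad_sets [measurable]: "bad C r \<in> sets borel"
proof -
  have "bad C r = (\<Union>\<Delta>\<in>C. {z. r * norm (Y *v \<Delta>) < z \<bullet> (Y *v \<Delta>) + lam * excess_penalty \<Delta>})"
    by (auto simp: bad_def)
  also have "open \<dots>" by (intro open_UN ballI open_Collect_less continuous_intros)
  finally show ?thesis by simp
qed

lemma card_S: "1 \<le> card S"
  using S by (simp add: Suc_le_eq card_gt_0_iff)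

lemma ln_p: "0 < ln (real CARD('p))"
  using card by simp

lemma lam_pos: "0 < lam"
  using lam ln_p by (smt (verit) real_sqrt_gt_zero)

text \<open>A coordinate vector with index in \<open>S\<close> lies in the cone and is mapped to a
  column, of norm at most 1.\<close>

lemma \<kappa>_le_1: "\<kappa> \<le> 1"
proof -
  obtain j where j: "j \<in> S" using S by blast
  have "l1_norm (restrict_vec (axis j 1) (- S)) = 0"
    unfolding l1_norm_restrict_vec using j by (intro sum.neutral) (auto simp: axis_def)
  then have "axis j 1 \<in> RE_cone S 3" using l1_norm_nonneg by (simp add: RE_cone_def)
  from RE[OF this] have "\<kappa> \<le> norm (column j Y)" by (simp add: matrix_vector_mult_basis)
  with col[of j] show ?thesis by linarith
qed

lemma t_over: "t / (2 * lam) = sqrt (card S) / \<kappa>"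
  using lam_pos by (simp add: t_def)

lemma t_ge: "4 * sqrt (2 * ln (real CARD('p))) \<le> t"
proof -
  have "\<kappa> \<le> 1" by (rule \<kappa>_le_1)
  also have "1 \<le> sqrt (card S)" using card_S by simp
  finally have "1 \<le> sqrt (card S) / \<kappa>" using \<kappa> by (subst pos_le_divide_eq) auto
  then have "2 * lam * 1 \<le> 2 * lam * (sqrt (card S) / \<kappa>)" using lam_pos by (intro mult_left_mono) auto
  then show ?thesis using lam by (simp add: t_def)
qed

lemma t_pos: "0 < t"
  using t_ge ln_p by (smt (verit) real_sqrt_gt_zero)

lemma cone_l1:
  assumes "\<Delta> \<in> RE_cone S 3"
  shows "l1_norm (restrict_vec \<Delta> S) \<le> t / (2 * lam) * norm (Y *v \<Delta>)"
proof -
  have "l1_norm (restrict_vec \<Delta> S) \<le> sqrt (card S) * norm \<Delta>" by (rule l1_norm_restrict_vec_le)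
  also have "\<dots> \<le> sqrt (card S) * (norm (Y *v \<Delta>) / \<kappa>)"
    using RE[OF assms] \<kappa> by (intro mult_left_mono) (auto simp: field_simps)
  finally show ?thesis by (simp add: t_over)
qed

text \<open>Moving from \<open>z\<close> to \<open>a\<close> costs \<open>norm (z - a) * N\<close>,
  and what is left is at most \<open>(lam + c) * A + (c - lam) * B\<close>. The \<open>B\<close>
  term is harmful only if \<open>c > lam\<close>, and then \<open>B \<le> 3 * A\<close>. Bounding
  \<open>A\<close> by \<open>t / (2 * lam) * N\<close>, the share of \<open>lam\<close> lowers 7/4
  to 5/4.\<close>

lemma bad_in_cone_dist:
  assumes z: "z \<in> bad (RE_cone S 3) (7 / 4 * t)" and c: "\<And>j. \<bar>column j Y \<bullet> a\<bar> \<le> c"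
  shows "5 / 4 * t - t / (2 * lam) * (c + 3 * max 0 (c - lam)) \<le> norm (z - a)"
proof -
  obtain \<Delta> where D: "\<Delta> \<in> RE_cone S 3"
    and less: "7 / 4 * t * norm (Y *v \<Delta>) < z \<bullet> (Y *v \<Delta>) + lam * excess_penalty \<Delta>"
    using z by (auto simp: bad_def)
  define N A B where "N = norm (Y *v \<Delta>)" and "A = l1_norm (restrict_vec \<Delta> S)" and "B = l1_norm (restrict_vec \<Delta> (- S))"
  define m where "m = max 0 (c - lam)"
  have AB: "0 \<le> A" "0 \<le> B" "B \<le> 3 * A" using D by (auto simp: A_def B_def l1_norm_nonneg RE_cone_def)
  have A: "A \<le> t / (2 * lam) * N" unfolding A_def N_def by (rule cone_l1[OF D])
  have c0: "0 \<le> c" using c[of undefined] by linarith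
  have "(c - lam) * B \<le> m * B" using AB by (intro mult_right_mono) (auto simp: m_def)
  also have "\<dots> \<le> m * (3 * A)" using AB by (intro mult_left_mono) (auto simp: m_def)
  finally have mB: "(c - lam) * B \<le> 3 * m * A" by simp
  have "z \<bullet> (Y *v \<Delta>) = (z - a) \<bullet> (Y *v \<Delta>) + a \<bullet> (Y *v \<Delta>)" by (simp add: inner_diff_left)
  also have "\<dots> \<le> norm (z - a) * N + c * (A + B)"
    using inner_matrix_vector_le[OF c, of \<Delta>] l1_norm_split[of \<Delta> S]
    unfolding N_def A_def B_def by (intro add_mono norm_cauchy_schwarz) auto
  finally have "7 / 4 * t * N < norm (z - a) * N + c * (A + B) + lam * (A - B)"
    using less by (simp add: N_def A_def B_def excess_penalty_def)
  also have "\<dots> = norm (z - a) * N + (lam + c) * A + (c - lam) * B" by (simp add: algebra_simps)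
  also have "\<dots> \<le> norm (z - a) * N + (lam + c + 3 * m) * A" using mB by (simp add: algebra_simps)
  also have "\<dots> \<le> norm (z - a) * N + (lam + c + 3 * m) * (t / (2 * lam) * N)"
    using A c0 lam_pos by (intro add_mono mult_left_mono) (auto simp: m_def)
  also have "\<dots> = (norm (z - a) + t / 2 + t / (2 * lam) * (c + 3 * m)) * N"
    using lam_pos by (simp add: field_simps)
  finally have "7 / 4 * t * N < (norm (z - a) + t / 2 + t / (2 * lam) * (c + 3 * m)) * N" .
  \<comment> \<open>Strictness permits cancelling \<open>N\<close>, which is only known to be
    nonnegative.\<close>
  then have "7 / 4 * t < norm (z - a) + t / 2 + t / (2 * lam) * (c + 3 * m)"
    by (rule mult_right_less_imp_less) (simp add: N_def)
  then show ?thesis by (simp add: m_def)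
qed

text \<open>At noise level \<open>lam / 2\<close> noise and penalty add up to at most
  \<open>lam / 2 * (3 * A - B)\<close>, which is negative outside the cone; this is where the cone
  constant 3 comes from. The whole margin 7/4 must then come from \<open>z - a\<close>.\<close>

lemma bad_out_cone_dist:
  assumes z: "z \<in> bad (- RE_cone S 3) (7 / 4 * t)" and c: "\<And>j. \<bar>column j Y \<bullet> a\<bar> \<le> lam / 2"
  shows "7 / 4 * t \<le> norm (z - a)"
proof -
  obtain \<Delta> where D: "\<Delta> \<notin> RE_cone S 3"
    and less: "7 / 4 * t * norm (Y *v \<Delta>) < z \<bullet> (Y *v \<Delta>) + lam * excess_penalty \<Delta>"
    using z by (auto simp: bad_def)
  define N A B where "N = norm (Y *v \<Delta>)" and "A = l1_norm (restrict_vec \<Delta> S)" and "B = l1_norm (restrict_vec \<Delta> (- S))"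
  have AB: "3 * A < B" using D by (auto simp: A_def B_def RE_cone_def)
  have "z \<bullet> (Y *v \<Delta>) = (z - a) \<bullet> (Y *v \<Delta>) + a \<bullet> (Y *v \<Delta>)" by (simp add: inner_diff_left)
  also have "\<dots> \<le> norm (z - a) * N + lam / 2 * (A + B)"
    using inner_matrix_vector_le[OF c, of \<Delta>] l1_norm_split[of \<Delta> S]
    unfolding N_def A_def B_def by (intro add_mono norm_cauchy_schwarz) auto
  finally have "7 / 4 * t * N < norm (z - a) * N + lam / 2 * (A + B) + lam * (A - B)"
    using less by (simp add: N_def A_def B_def excess_penalty_def)
  also have "\<dots> = norm (z - a) * N + lam / 2 * (3 * A - B)" by (simp add: field_simps)
  also have "\<dots> \<le> norm (z - a) * N" using AB lam_pos by (simp add: mult_le_0_iff)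
  finally have "7 / 4 * t < norm (z - a)" by (rule mult_right_less_imp_less) (simp add: N_def)
  then show ?thesis by simp
qed

lemma bad_subset_Un: "bad UNIV r \<subseteq> bad (RE_cone S 3) r \<union> bad (- RE_cone S 3) r"
  by (auto simp: bad_def)

lemma prob_bad_large:
  assumes p: "16 \<le> CARD('p)"
  shows "measure std_gaussian (bad UNIV (7 / 4 * t)) \<le> exp (- t\<^sup>2 / 2)"
proof -
  define L where "L = sqrt (2 * ln (real CARD('p)))"
  interpret gaussian_levels "real CARD('p)" L "sqrt (2 * ln (real CARD('p) / 2))"
    using p by unfold_locales (auto simp: L_def)
  interpret G: prob_space "std_gaussian :: (real ^ 'n) measure" by (rule prob_space_std_gaussian)
  let ?x = "\<lambda>j. column j Y"
  have tL: "4 * L \<le> t" and lamL: "2 * L \<le> lam" using t_ge lam by (simp_all add: L_def)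
  \<comment> \<open>As \<open>2 * L \<le> lam\<close>, this lies below the distance bound of
    \<open>bad_in_cone_dist\<close> taken at the maximal noise \<open>c\<close>.\<close>
  let ?D = "\<lambda>a. 5 / 4 * t - t / (4 * L) * excess ?x a"
  have le: "t / (2 * lam) \<le> t / (4 * L)" using t_pos L_pos lamL by (intro divide_left_mono) auto
  have coef: "0 \<le> t / (4 * L)" using t_pos L_pos by simp
  have int: "integrable std_gaussian ?D" using integrable_excess[of ?x, OF col refl] by auto
  have "measure std_gaussian (bad (RE_cone S 3) (7 / 4 * t)) \<le> exp (- (t * (5 / 4 - w / (4 * L)))\<^sup>2 / 2)"
  proof (rule std_gaussian_concentration[OF bad_sets int])
    show "?D a \<le> 5 / 4 * t" for a using mult_nonneg_nonneg[OF coef excess_nonneg, of ?x a] by linarith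
    show "?D a \<le> norm (z - a)" if "z \<in> bad (RE_cone S 3) (7 / 4 * t)" for z a
    proof -
      define c where "c = (MAX j. \<bar>?x j \<bullet> a\<bar>)"
      have c: "\<bar>column j Y \<bullet> a\<bar> \<le> c" for j unfolding c_def by (rule Max_ge) auto
      have "c + 3 * max 0 (c - lam) \<le> c + 3 * max 0 (c - 2 * L)" using lamL by simp
      also have "\<dots> \<le> excess ?x a" by (rule le_excess[OF c_def])
      finally have "t / (2 * lam) * (c + 3 * max 0 (c - lam)) \<le> t / (4 * L) * excess ?x a"
        using le coef t_pos lam_pos c[of undefined] by (intro mult_mono) auto
      with bad_in_cone_dist[OF that c] show ?thesis by linarith
    qed
    have "t * (5 / 4 - w / (4 * L)) = 5 / 4 * t - t / (4 * L) * w" by (simp add: algebra_simps)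
    also have "\<dots> \<le> 5 / 4 * t - t / (4 * L) * (\<integral>a. excess ?x a \<partial>std_gaussian)"
      by (intro diff_left_mono mult_left_mono expectation_excess col coef refl)
    also have "\<dots> = (\<integral>a. ?D a \<partial>std_gaussian)"
      using integrable_excess[of ?x, OF col refl] G.prob_space by simp
    finally show "t * (5 / 4 - w / (4 * L)) \<le> (\<integral>a. ?D a \<partial>std_gaussian)" .
    have "w / (4 * L) \<le> 1 / 4" using w_le_L L_pos by (simp add: field_simps)
    then show "0 \<le> t * (5 / 4 - w / (4 * L))" using t_pos by (intro mult_nonneg_nonneg) auto
  qed
  moreover have "measure std_gaussian (bad (- RE_cone S 3) (7 / 4 * t)) \<le> exp (- (3 / 5 * ((7 / 4 * t)\<^sup>2 / 2)))"
  proof -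
    define T where "T = {a. \<exists>j. L < \<bar>?x j \<bullet> a\<bar>}"
    have T: "T \<in> sets borel"
    proof -
      have "T = (\<Union>j\<in>UNIV. {a. L < \<bar>?x j \<bullet> a\<bar>})" by (auto simp: T_def)
      also have "open \<dots>" by (intro open_UN ballI open_Collect_less continuous_intros)
      finally show ?thesis by simp
    qed
    \<comment> \<open>Off \<open>T\<close> the distance is at least \<open>7 / 4 * t\<close>, and
      \<open>T\<close> has mass at most 2/5, so the mean retains the factor 3/5.\<close>
    let ?g = "\<lambda>a. (7 / 4 * t)\<^sup>2 / 2 * indicator (- T) a"
    have "measure std_gaussian (bad (- RE_cone S 3) (7 / 4 * t)) \<le> exp (- (\<integral>a. ?g a \<partial>std_gaussian))"
    proof (rule std_gaussian_measure_le_exp[OF bad_sets])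
      show "integrable std_gaussian ?g" using T by (intro integrable_mult_right integrable_real_indicator) (auto simp: G.emeasure_eq_measure)
      show "?g a \<le> (7 / 4 * t)\<^sup>2 / 2" for a by (intro mult_left_le) (auto simp: indicator_def)
      show "?g a \<le> (norm (z - a))\<^sup>2 / 2" if "z \<in> bad (- RE_cone S 3) (7 / 4 * t)" for z a
      proof (cases "a \<in> T")
        case False
        then have "\<bar>column j Y \<bullet> a\<bar> \<le> L" for j by (auto simp: T_def not_less)
        also have "L \<le> lam / 2" using lamL by simp
        finally have "\<bar>column j Y \<bullet> a\<bar> \<le> lam / 2" for j .
        from bad_out_cone_dist[OF that this] have "(7 / 4 * t)\<^sup>2 \<le> (norm (z - a))\<^sup>2"
          using t_pos by (intro power_mono) auto
        then show ?thesis using False by simp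
      qed simp
    qed
    also have "(\<integral>a. ?g a \<partial>std_gaussian) = (7 / 4 * t)\<^sup>2 / 2 * measure std_gaussian (- T)" by simp
    also have "measure std_gaussian (- T) = 1 - measure std_gaussian T"
      using G.prob_compl[of T] T by (simp add: Compl_eq_Diff_UNIV)
    also have "exp (- ((7 / 4 * t)\<^sup>2 / 2 * (1 - measure std_gaussian T))) \<le> exp (- (3 / 5 * ((7 / 4 * t)\<^sup>2 / 2)))"
    proof -
      have "3 / 5 \<le> 1 - measure std_gaussian T" using union_bound[of ?x, OF col refl] by (simp add: T_def)
      then have "(7 / 4 * t)\<^sup>2 / 2 * (3 / 5) \<le> (7 / 4 * t)\<^sup>2 / 2 * (1 - measure std_gaussian T)"
        by (intro mult_left_mono) auto
      then show ?thesis by simp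
    qed
    finally show ?thesis .
  qed
  moreover have "measure std_gaussian (bad UNIV (7 / 4 * t))
      \<le> measure std_gaussian (bad (RE_cone S 3) (7 / 4 * t)) + measure std_gaussian (bad (- RE_cone S 3) (7 / 4 * t))"
    by (rule order.trans[OF G.finite_measure_mono[OF bad_subset_Un] measure_Un_le]) auto
  ultimately show ?thesis using exponent_slack[OF tL] by linarith
qed

text \<open>The penalty is worth at most \<open>t / 2 * norm (Y *v \<Delta>)\<close> in the cone and
  at most 0 outside, so a bad \<open>z\<close> has a projection of length at least
  \<open>5 / 4 * t\<close> onto the range of \<open>Y\<close>, whose dimension is at most
  \<open>CARD('p)\<close>.\<close>

lemma prob_bad_small:
  assumes p: "CARD('p) \<le> 15"
  shows "measure std_gaussian (bad UNIV (7 / 4 * t)) \<le> exp (- t\<^sup>2 / 2)"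
proof -
  interpret G: prob_space "std_gaussian :: (real ^ 'n) measure" by (rule prob_space_std_gaussian)
  let ?R = "range (\<lambda>j. column j Y)"
  obtain E where E: "pairwise orthogonal E" "\<And>e. e \<in> E \<Longrightarrow> norm e = 1" "independent E"
    "card E = dim (span ?R)" "span E = span ?R"
    using orthonormal_basis_subspace[OF subspace_span[of ?R]] by metis
  have finE: "finite E" using E(3) by (rule independent_imp_finite)
  have "card E \<le> card ?R" unfolding E(4) dim_span by (rule dim_le_card') simp
  also have "\<dots> \<le> CARD('p)" by (rule card_image_le) simp
  finally have cE: "card E \<le> CARD('p)" .
  let ?r = "(5 / 4 * t)\<^sup>2"
  have sub: "bad UNIV (7 / 4 * t) \<subseteq> {z. ?r \<le> (\<Sum>e\<in>E. (e \<bullet> z)\<^sup>2)}"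
  proof
    fix z assume "z \<in> bad UNIV (7 / 4 * t)"
    then obtain \<Delta> where less: "7 / 4 * t * norm (Y *v \<Delta>) < z \<bullet> (Y *v \<Delta>) + lam * excess_penalty \<Delta>"
      by (auto simp: bad_def)
    have "lam * excess_penalty \<Delta> \<le> t / 2 * norm (Y *v \<Delta>)"
    proof (cases "\<Delta> \<in> RE_cone S 3")
      case True
      have "lam * excess_penalty \<Delta> \<le> lam * (t / (2 * lam) * norm (Y *v \<Delta>))"
        using cone_l1[OF True] l1_norm_nonneg[of "restrict_vec \<Delta> (- S)"] lam_pos
        by (intro mult_left_mono) (auto simp: excess_penalty_def)
      then show ?thesis using lam_pos by simp
    next
      case False
      then have "excess_penalty \<Delta> \<le> 0"
        using l1_norm_nonneg[of "restrict_vec \<Delta> S"] by (simp add: excess_penalty_def RE_cone_def)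
      then have "lam * excess_penalty \<Delta> \<le> 0" using lam_pos by (simp add: mult_le_0_iff)
      also have "0 \<le> t / 2 * norm (Y *v \<Delta>)" using t_pos by simp
      finally show ?thesis .
    qed
    with less have less': "5 / 4 * t * norm (Y *v \<Delta>) < z \<bullet> (Y *v \<Delta>)" by (simp add: algebra_simps)
    have "Y *v \<Delta> \<in> span E"
      unfolding E(5) matrix_mult_sum scalar_mult_eq_scaleR by (intro span_sum span_scale span_base rangeI)
    note less'
    also have "z \<bullet> (Y *v \<Delta>) \<le> sqrt (\<Sum>e\<in>E. (e \<bullet> z)\<^sup>2) * norm (Y *v \<Delta>)"
      by (rule inner_span_le) fact+
    finally have "5 / 4 * t < sqrt (\<Sum>e\<in>E. (e \<bullet> z)\<^sup>2)"
      by (rule mult_right_less_imp_less) simp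
    then have "?r \<le> (sqrt (\<Sum>e\<in>E. (e \<bullet> z)\<^sup>2))\<^sup>2" using t_pos by (intro power_mono) auto
    then show "z \<in> {z. ?r \<le> (\<Sum>e\<in>E. (e \<bullet> z)\<^sup>2)}" by (simp add: sum_nonneg)
  qed
  have sqrt8: "sqrt 8 ^ CARD('p) = exp (3 / 2 * real CARD('p) * ln 2)"
  proof -
    have "ln (sqrt 8 :: real) = 3 / 2 * ln 2" using ln_realpow[of 2 3] by (simp add: ln_sqrt)
    then have "exp (3 / 2 * ln 2) = sqrt (8 :: real)" by (metis exp_ln real_sqrt_gt_zero zero_less_numeral)
    then have "sqrt 8 ^ CARD('p) = exp (3 / 2 * ln 2) ^ CARD('p)" by simp
    then show ?thesis by (simp only: exp_of_nat_mult[symmetric] mult_ac)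
  qed
  have "measure std_gaussian (bad UNIV (7 / 4 * t)) \<le> measure std_gaussian {z. ?r \<le> (\<Sum>e\<in>E. (e \<bullet> z)\<^sup>2)}"
    by (rule G.finite_measure_mono[OF sub]) simp
  \<comment> \<open>The choice \<open>\<theta> = 7 / 8\<close> costs a factor \<open>sqrt 8\<close>
    per dimension, a power of 2, so that the final comparison is one between integers.\<close>
  also have "\<dots> \<le> exp (- (7 / 8 * ?r / 2)) * (1 / sqrt (1 - 7 / 8)) ^ card E"
    by (rule std_gaussian_proj_tail[OF finE E(1,2)]) auto
  also have "\<dots> \<le> exp (- (7 / 8 * ?r / 2)) * sqrt 8 ^ CARD('p)"
    using cE by (intro mult_left_mono) (auto simp: real_sqrt_divide intro!: power_increasing)
  also have "\<dots> = exp (- (7 / 8 * ?r / 2)) * exp (3 / 2 * real CARD('p) * ln 2)" by (simp only: sqrt8)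
  also have "\<dots> \<le> exp (- t\<^sup>2 / 2)"
  proof -
    \<comment> \<open>Since \<open>7 / 8 * (5 / 4)\<^sup>2 - 1 = 47 / 128\<close> and \<open>t\<^sup>2 \<ge> 32 * ln p\<close>, what remains is \<open>12 * p * ln 2 \<le> 47 * ln p\<close>.\<close>
    have "(2 :: real) ^ (12 * CARD('p)) \<le> real CARD('p) ^ 47"
    proof -
      \<comment> \<open>At \<open>q = 16\<close> the exponents of 2 would be 192 and 188, so this
        comparison first fails there; hence the case split at 15.\<close>
      have "2 ^ (12 * q) \<le> q ^ 47" if "2 \<le> q" "q \<le> 15" for q :: nat
      proof -
        have "q = 2 \<or> q = 3 \<or> q = 4 \<or> q = 5 \<or> q = 6 \<or> q = 7 \<or> q = 8 \<or> q = 9 \<or> q = 10 \<or> q = 11 \<or> q = 12 \<or> q = 13 \<or> q = 14 \<or> q = 15" using that by presburger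
        then show ?thesis by (elim disjE) simp_all
      qed
      then have "2 ^ (12 * CARD('p)) \<le> CARD('p) ^ 47" using p card by auto
      then show ?thesis by (metis of_nat_le_iff of_nat_numeral of_nat_power)
    qed
    then have "ln ((2 :: real) ^ (12 * CARD('p))) \<le> ln (real CARD('p) ^ 47)"
      using card by (intro ln_mono) auto
    then have 1: "12 * real CARD('p) * ln 2 \<le> 47 * ln (real CARD('p))"
      using card by (simp add: ln_realpow)
    have "(4 * sqrt (2 * ln (real CARD('p))))\<^sup>2 \<le> t\<^sup>2" using t_ge ln_p by (intro power_mono) auto
    then have 2: "32 * ln (real CARD('p)) \<le> t\<^sup>2" using ln_p by (simp add: power_mult_distrib)
    have "- (7 / 8 * ?r / 2) + 3 / 2 * real CARD('p) * ln 2 \<le> - t\<^sup>2 / 2"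
      using 1 2 by (simp add: power_mult_distrib power_divide)
    then show ?thesis by (simp only: exp_add[symmetric] exp_le_cancel_iff)
  qed
  finally show ?thesis .
qed

lemma prob_bad: "measure std_gaussian (bad UNIV (7 / 4 * t)) \<le> exp (- t\<^sup>2 / 2)"
  using prob_bad_small prob_bad_large by (cases "CARD('p) \<le> 15") auto

end

subsection \<open>The normal density\<close>

lemma PiM_std_normal_density:
  assumes "finite I"
  shows "PiM I (\<lambda>_. std_normal_distribution)
    = density (PiM I (\<lambda>_. lborel)) (\<lambda>x. ennreal (\<Prod>i\<in>I. std_normal_density (x i)))"
proof -
  interpret N: prob_space std_normal_distribution using prob_space_normal_density by simp
  interpret PN: product_sigma_finite "\<lambda>_. std_normal_distribution" ..
  interpret PL: product_sigma_finite "\<lambda>_. lborel :: real measure" ..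
  have m: "(\<lambda>x. ennreal (\<Prod>i\<in>I. std_normal_density (x i))) \<in> borel_measurable (PiM I (\<lambda>_. lborel))"
    by (intro measurable_compose[OF _ measurable_ennreal] borel_measurable_prod
        measurable_compose[OF measurable_component_singleton[of _ I "\<lambda>_. lborel"]]) auto
  have "density (PiM I (\<lambda>_. lborel)) (\<lambda>x. ennreal (\<Prod>i\<in>I. std_normal_density (x i))) = PiM I (\<lambda>_. std_normal_distribution)"
  proof (rule PN.PiM_eqI)
    show "sets (density (PiM I (\<lambda>_. lborel)) (\<lambda>x. ennreal (\<Prod>i\<in>I. std_normal_density (x i)))) = PiM I (\<lambda>_. std_normal_distribution)"
      by (simp cong: sets_PiM_cong)
    fix A :: "'a \<Rightarrow> real set" assume "\<And>i. i \<in> I \<Longrightarrow> A i \<in> sets std_normal_distribution"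
    then have A: "A i \<in> sets borel" if "i \<in> I" for i using that by simp
    have PA: "Pi\<^sub>E I A \<in> sets (PiM I (\<lambda>_. lborel))"
      using assms A by (intro sets_PiM_I_finite) auto
    have "emeasure (density (PiM I (\<lambda>_. lborel)) (\<lambda>x. ennreal (\<Prod>i\<in>I. std_normal_density (x i)))) (Pi\<^sub>E I A)
      = (\<integral>\<^sup>+x. ennreal (\<Prod>i\<in>I. std_normal_density (x i)) * indicator (Pi\<^sub>E I A) x \<partial>PiM I (\<lambda>_. lborel))"
      using m PA by (rule emeasure_density)
    also have "\<dots> = (\<integral>\<^sup>+x. (\<Prod>i\<in>I. ennreal (std_normal_density (x i)) * indicator (A i) (x i)) \<partial>PiM I (\<lambda>_. lborel))"
    proof (rule nn_integral_cong)
      fix x assume x: "x \<in> space (PiM I (\<lambda>_. lborel :: real measure))"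
      have "indicator (Pi\<^sub>E I A) x = (\<Prod>i\<in>I. indicator (A i) (x i) :: ennreal)"
      proof (cases "x \<in> Pi\<^sub>E I A")
        case False
        then obtain i where "i \<in> I" "x i \<notin> A i" using x by (auto simp: space_PiM PiE_iff)
        then have "(\<Prod>i\<in>I. indicator (A i) (x i) :: ennreal) = 0" using assms by (auto intro!: bexI[of _ i])
        then show ?thesis using False by simp
      qed (auto simp: PiE_iff)
      then show "ennreal (\<Prod>i\<in>I. std_normal_density (x i)) * indicator (Pi\<^sub>E I A) x
        = (\<Prod>i\<in>I. ennreal (std_normal_density (x i)) * indicator (A i) (x i))"
        by (simp add: prod.distrib prod_ennreal)
    qed
    also have "\<dots> = (\<Prod>i\<in>I. \<integral>\<^sup>+x. ennreal (std_normal_density x) * indicator (A i) x \<partial>lborel)"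
      using A assms by (intro PL.product_nn_integral_prod) auto
    also have "\<dots> = (\<Prod>i\<in>I. emeasure std_normal_distribution (A i))"
      using A by (intro prod.cong) (auto simp: emeasure_density)
    finally show "emeasure (density (PiM I (\<lambda>_. lborel)) (\<lambda>x. ennreal (\<Prod>i\<in>I. std_normal_density (x i)))) (Pi\<^sub>E I A)
      = (\<Prod>i\<in>I. emeasure std_normal_distribution (A i))" .
  qed fact
  then show ?thesis by simp
qed

text \<open>Needed to identify the law built from coordinates with the one given by
  \<open>multivariate_normal_density\<close>.\<close>

lemma std_gaussian_eq_density:
  "(std_gaussian :: 'a::euclidean_space measure) = density lborel (\<lambda>x. ennreal (\<Prod>b\<in>Basis. std_normal_density (x \<bullet> b)))"
proof (rule measure_eqI)
  let ?T = "\<lambda>f. \<Sum>b\<in>(Basis :: 'a set). f b *\<^sub>R b"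
  let ?L = "PiM (Basis :: 'a set) (\<lambda>_. lborel :: real measure)"
  have T: "?T \<in> borel_measurable ?L"
  proof (intro borel_measurable_sum borel_measurable_scaleR)
    fix b :: 'a assume "b \<in> Basis"
    then show "(\<lambda>f. f b) \<in> borel_measurable ?L"
      using measurable_component_singleton[of b Basis "\<lambda>_. lborel"] by simp
  qed simp
  have Tb: "?T f \<bullet> b = f b" if "b \<in> Basis" for f b
    using that by (simp add: inner_sum_left inner_Basis if_distrib cong: if_cong)
  have m: "(\<lambda>x. ennreal (\<Prod>i\<in>Basis. std_normal_density (x i))) \<in> borel_measurable ?L"
    by (intro measurable_compose[OF _ measurable_ennreal] borel_measurable_prod
        measurable_compose[OF measurable_component_singleton[of _ Basis "\<lambda>_. lborel"]]) auto
  fix A :: "'a set" assume "A \<in> sets std_gaussian"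
  then have A [measurable]: "A \<in> sets borel" by simp
  have vA: "?T -` A \<inter> space ?L \<in> sets ?L" using T A by (rule measurable_sets)
  have "emeasure std_gaussian A = emeasure (PiM Basis (\<lambda>_. std_normal_distribution)) (?T -` A \<inter> space (PiM Basis (\<lambda>_. std_normal_distribution)))"
    unfolding std_gaussian_def by (rule emeasure_distr[OF measurable_from_coordinates A])
  also have "\<dots> = (\<integral>\<^sup>+f. ennreal (\<Prod>b\<in>Basis. std_normal_density (f b)) * indicator (?T -` A \<inter> space ?L) f \<partial>?L)"
    unfolding PiM_std_normal_density[OF finite_Basis] space_density by (rule emeasure_density[OF m vA])
  also have "\<dots> = (\<integral>\<^sup>+f. ennreal (\<Prod>b\<in>Basis. std_normal_density (?T f \<bullet> b)) * indicator A (?T f) \<partial>?L)"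
    by (intro nn_integral_cong) (auto simp: Tb indicator_def)
  also have "\<dots> = (\<integral>\<^sup>+x. ennreal (\<Prod>b\<in>Basis. std_normal_density (x \<bullet> b)) * indicator A x \<partial>lborel)"
    by (subst lborel_eq, subst nn_integral_distr[OF T]) auto
  also have "\<dots> = emeasure (density lborel (\<lambda>x. ennreal (\<Prod>b\<in>Basis. std_normal_density (x \<bullet> b)))) A"
    by (subst emeasure_density) auto
  finally show "emeasure std_gaussian A = emeasure (density lborel (\<lambda>x. ennreal (\<Prod>b\<in>Basis. std_normal_density (x \<bullet> b)))) A" .
qed simp

text \<open>The factor \<open>\<sigma> ^ CARD('n)\<close> is the Jacobian of the dilation by
  \<open>\<sigma>\<close>; it cancels the determinant of the covariance.\<close>

lemma multivariate_normal_density_scaled: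
  fixes x :: "real ^ 'n"
  assumes \<sigma>: "0 < \<sigma>"
  shows "\<sigma> ^ CARD('n) * multivariate_normal_density 0 (\<sigma>\<^sup>2 *\<^sub>R mat 1) (\<sigma> *\<^sub>R x) = (\<Prod>b\<in>Basis. std_normal_density (x \<bullet> b))"
proof -
  let ?A = "\<sigma>\<^sup>2 *\<^sub>R mat 1 :: real ^ 'n ^ 'n"
  have Av: "?A *v v = \<sigma>\<^sup>2 *\<^sub>R v" for v by (simp add: scaleR_matrix_vector_assoc[symmetric])
  have eq: "?A = matrix ((*\<^sub>R) (\<sigma>\<^sup>2))" by (simp add: matrix_def mat_def vec_eq_iff axis_def)
  have det: "det ?A = (\<sigma>\<^sup>2) ^ CARD('n)" unfolding eq by simp
  have "invertible ?A" using det \<sigma> by (simp add: invertible_det_nz)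
  then have "?A ** matrix_inv ?A = mat 1"
    unfolding invertible_def matrix_inv_def by (metis (mono_tags, lifting) someI_ex)
  \<comment> \<open>The inverse covariance matters only through its action on vectors, which this
    equation determines because \<open>?A\<close> acts as a scalar.\<close>
  then have "?A *v (matrix_inv ?A *v v) = v" for v by (simp add: matrix_vector_mul_assoc)
  then have inv: "\<sigma>\<^sup>2 *\<^sub>R (matrix_inv ?A *v v) = v" for v unfolding Av .
  have q: "(\<sigma> *\<^sub>R x) \<bullet> (matrix_inv ?A *v (\<sigma> *\<^sub>R x)) = x \<bullet> x"
    using inv[of x] by (simp add: matrix_vector_mult_scaleR power2_eq_square) (metis inner_scaleR_right mult.assoc)
  have d: "sqrt ((2 * pi) ^ CARD('n) * det ?A) = sqrt (2 * pi) ^ CARD('n) * \<sigma> ^ CARD('n)"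
    using \<sigma> by (simp add: det real_sqrt_mult real_sqrt_power power_mult_distrib)
  have "(\<Prod>b\<in>Basis. std_normal_density (x \<bullet> b)) = (1 / sqrt (2 * pi)) ^ CARD('n) * exp (\<Sum>b\<in>Basis. - (x \<bullet> b)\<^sup>2 / 2)"
    unfolding std_normal_density_def prod.distrib by (simp add: exp_sum)
  also have "(\<Sum>b\<in>Basis. - (x \<bullet> b)\<^sup>2 / 2) = - (x \<bullet> x) / 2"
    by (simp add: euclidean_inner[of x x] power2_eq_square sum_negf sum_divide_distrib)
  finally show ?thesis
    using \<sigma> unfolding multivariate_normal_density_def diff_zero q d by (simp add: power_one_over)
qed

lemma distr_multivariate_normal:
  fixes \<xi> :: "'a \<Rightarrow> real ^ 'n"
  assumes D: "distributed M lborel \<xi> (multivariate_normal_density 0 (\<sigma>\<^sup>2 *\<^sub>R mat 1))" and \<sigma>: "0 < \<sigma>"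
  shows "distr M borel (\<lambda>\<omega>. (1 / \<sigma>) *\<^sub>R \<xi> \<omega>) = std_gaussian"
proof (rule measure_eqI)
  let ?F = "multivariate_normal_density 0 (\<sigma>\<^sup>2 *\<^sub>R mat 1 :: real ^ 'n ^ 'n)"
  have \<xi> [measurable]: "\<xi> \<in> borel_measurable M" using distributed_measurable[OF D] by simp
  have F [measurable]: "(\<lambda>x. ennreal (?F x)) \<in> borel_measurable borel" using distributed_borel_measurable[OF D] by simp
  fix A :: "(real ^ 'n) set" assume "A \<in> sets (distr M borel (\<lambda>\<omega>. (1 / \<sigma>) *\<^sub>R \<xi> \<omega>))"
  then have A [measurable]: "A \<in> sets borel" by simp
  have "emeasure (distr M borel (\<lambda>\<omega>. (1 / \<sigma>) *\<^sub>R \<xi> \<omega>)) A = (\<integral>\<^sup>+z. indicator A z \<partial>distr M borel (\<lambda>\<omega>. (1 / \<sigma>) *\<^sub>R \<xi> \<omega>))" by simp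
  also have "\<dots> = (\<integral>\<^sup>+\<omega>. indicator A ((1 / \<sigma>) *\<^sub>R \<xi> \<omega>) \<partial>M)" by (subst nn_integral_distr) auto
  also have "\<dots> = (\<integral>\<^sup>+x. ennreal (?F x) * indicator A ((1 / \<sigma>) *\<^sub>R x) \<partial>lborel)"
    by (rule distributed_nn_integral[OF D, symmetric]) measurable
  also have "\<dots> = (\<integral>\<^sup>+x. ennreal (\<bar>\<sigma>\<bar> ^ DIM(real ^ 'n)) * (ennreal (?F (0 + \<sigma> *\<^sub>R x)) * indicator A ((1 / \<sigma>) *\<^sub>R (0 + \<sigma> *\<^sub>R x))) \<partial>lborel)"
    using \<sigma> by (subst lborel_affine[of \<sigma> 0]) (simp_all add: nn_integral_density nn_integral_distr)
  also have "\<dots> = (\<integral>\<^sup>+x. ennreal (\<Prod>b\<in>Basis. std_normal_density (x \<bullet> b)) * indicator A x \<partial>lborel)"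
    using \<sigma> by (intro nn_integral_cong)
      (simp add: multivariate_normal_density_scaled[OF \<sigma>, symmetric] ennreal_mult' mult.assoc)
  also have "\<dots> = emeasure std_gaussian A"
    unfolding std_gaussian_eq_density by (subst emeasure_density) auto
  finally show "emeasure (distr M borel (\<lambda>\<omega>. (1 / \<sigma>) *\<^sub>R \<xi> \<omega>)) A = emeasure std_gaussian A" .
qed simp

subsection \<open>The LASSO fit\<close>

lemma scaled_norm_eq: "scaled_norm (u :: real ^ 'n) = norm u / sqrt (real CARD('n))"
  by (simp add: scaled_norm_def norm_vec_def L2_set_def real_sqrt_divide)

lemma l1_norm_convex_combination_le: "0 \<le> e \<Longrightarrow> e \<le> 1 \<Longrightarrow> l1_norm ((1 - e) *\<^sub>R u + e *\<^sub>R v) \<le> (1 - e) * l1_norm u + e * l1_norm v"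
  unfolding l1_norm_def sum_distrib_left sum.distrib[symmetric]
  by (intro sum_mono) (auto intro!: order.trans[OF abs_triangle_ineq] simp: abs_mult)

text \<open>First order condition: compare \<open>b\<close> with points on the segment towards
  \<open>\<beta>\<close>, bound the penalty there by convexity, divide by the step \<open>e\<close>
  and let it tend to 0. Unlike a direct comparison of \<open>b\<close> with \<open>\<beta>\<close>,
  this yields leading constant 1 in the oracle inequality.\<close>

lemma lasso_variational:
  fixes X :: "real ^ 'p ^ 'n"
  assumes b: "is_lasso X y lam b" and lam: "0 \<le> lam"
  shows "0 \<le> (y - X *v b) \<bullet> (X *v (b - \<beta>)) / real CARD('n) + lam * (l1_norm \<beta> - l1_norm b)"
proof -
  let ?n = "real CARD('n)" and ?r = "y - X *v b" and ?h = "X *v (b - \<beta>)"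
  let ?G = "\<lambda>e. (2 * (?r \<bullet> ?h) + e * (?h \<bullet> ?h)) / ?n + 2 * lam * (l1_norm \<beta> - l1_norm b)"
  have sq: "(scaled_norm u)\<^sup>2 = (u \<bullet> u) / ?n" for u :: "real ^ 'n"
    by (simp add: scaled_norm_eq power_divide dot_square_norm)
  have G: "0 \<le> ?G e" if e: "0 < e" "e < 1" for e
  proof -
    let ?b = "(1 - e) *\<^sub>R b + e *\<^sub>R \<beta>"
    have y: "y - X *v ?b = ?r + e *\<^sub>R ?h"
      by (simp add: matrix_vector_right_distrib matrix_vector_mult_diff_distrib matrix_vector_mult_scaleR algebra_simps)
    have "(?r \<bullet> ?r) / ?n + 2 * lam * l1_norm b \<le> ((?r + e *\<^sub>R ?h) \<bullet> (?r + e *\<^sub>R ?h)) / ?n + 2 * lam * l1_norm ?b"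
      using b unfolding is_lasso_def is_arg_min_def sq y[symmetric] by (auto simp: not_less)
    also have "\<dots> \<le> ((?r + e *\<^sub>R ?h) \<bullet> (?r + e *\<^sub>R ?h)) / ?n + 2 * lam * ((1 - e) * l1_norm b + e * l1_norm \<beta>)"
      using lam e by (intro add_left_mono mult_left_mono l1_norm_convex_combination_le) auto
    also have "(?r + e *\<^sub>R ?h) \<bullet> (?r + e *\<^sub>R ?h) = ?r \<bullet> ?r + e * (2 * (?r \<bullet> ?h) + e * (?h \<bullet> ?h))"
      by (simp add: inner_add_left inner_add_right inner_commute algebra_simps)
    finally have "0 \<le> (?r \<bullet> ?r + e * (2 * (?r \<bullet> ?h) + e * (?h \<bullet> ?h))) / ?n + 2 * lam * ((1 - e) * l1_norm b + e * l1_norm \<beta>)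
        - ((?r \<bullet> ?r) / ?n + 2 * lam * l1_norm b)" by linarith
    also have "(R + e * Q) / n + 2 * lam * ((1 - e) * u + e * v) - (R / n + 2 * lam * u) = e * (Q / n + 2 * lam * (v - u))"
      for R Q n u v :: real by (simp add: add_divide_distrib algebra_simps)
    finally have "0 \<le> e * ?G e" .
    then show ?thesis using e by (simp add: zero_le_mult_iff)
  qed
  have "(\<lambda>k. ?G (1 / real (k + 2))) \<longlonglongrightarrow> (2 * (?r \<bullet> ?h) + 0 * (?h \<bullet> ?h)) / ?n + 2 * lam * (l1_norm \<beta> - l1_norm b)"
    by (intro tendsto_intros LIMSEQ_ignore_initial_segment lim_1_over_n) auto
  then have "0 \<le> (2 * (?r \<bullet> ?h) + 0 * (?h \<bullet> ?h)) / ?n + 2 * lam * (l1_norm \<beta> - l1_norm b)"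
  proof (rule tendsto_lowerbound)
    have "0 \<le> ?G (1 / real (k + 2))" for k by (rule G) auto
    then show "eventually (\<lambda>k. 0 \<le> ?G (1 / real (k + 2))) sequentially" by (intro always_eventually allI)
  qed simp
  then show ?thesis by simp
qed

text \<open>Test each minimiser against the other and add: the penalties cancel, leaving
  \<open>?h \<bullet> ?h \<le> (y - y') \<bullet> ?h\<close>.\<close>

lemma lasso_fit_nonexpansive:
  fixes X :: "real ^ 'p ^ 'n"
  assumes "is_lasso X y lam b" "is_lasso X y' lam b'" and lam: "0 \<le> lam"
  shows "norm (X *v b - X *v b') \<le> norm (y - y')"
proof -
  let ?h = "X *v (b - b')"
  have "0 \<le> ((y - X *v b) \<bullet> ?h) / real CARD('n) + ((y' - X *v b') \<bullet> (X *v (b' - b))) / real CARD('n)"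
    using lasso_variational[OF assms(1) lam, of b'] lasso_variational[OF assms(2) lam, of b]
    by (simp add: algebra_simps)
  also have "X *v (b' - b) = - ?h" by (simp add: matrix_vector_mult_diff_distrib)
  finally have "0 \<le> ((y - X *v b) \<bullet> ?h - (y' - X *v b') \<bullet> ?h) / real CARD('n)" by (simp add: diff_divide_distrib)
  then have "0 \<le> (y - X *v b) \<bullet> ?h - (y' - X *v b') \<bullet> ?h" by (simp add: zero_le_divide_iff)
  also have "\<dots> = (y - y') \<bullet> ?h - ?h \<bullet> ?h" by (simp add: matrix_vector_mult_diff_distrib inner_diff_left inner_diff_right)
  finally have "?h \<bullet> ?h \<le> (y - y') \<bullet> ?h" by simp
  also have "\<dots> \<le> norm (y - y') * norm ?h" by (rule norm_cauchy_schwarz)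
  finally have "norm ?h * norm ?h \<le> norm (y - y') * norm ?h" by (simp add: dot_square_norm power2_eq_square)
  then have "norm ?h \<le> norm (y - y')" by (cases "?h = 0") auto
  then show ?thesis by (simp add: matrix_vector_mult_diff_distrib)
qed

text \<open>The first order condition and the noise bound give
  \<open>?p \<bullet> ?h / n \<le> r * scaled_norm ?h\<close>. Polarisation supplies a term
  \<open>- (scaled_norm ?h)\<^sup>2\<close> that absorbs the right side up to
  \<open>r\<^sup>2\<close>.\<close>

lemma lasso_oracle_inequality:
  fixes X :: "real ^ 'p ^ 'n"
  assumes b: "is_lasso X (f + \<xi>) lam b" and lam: "0 \<le> lam" and \<beta>: "Supp \<beta> = S" and r: "0 \<le> r"
    and noise: "\<And>\<Delta>. \<xi> \<bullet> (X *v \<Delta>) / real CARD('n)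
          + lam * (l1_norm (restrict_vec \<Delta> S) - l1_norm (restrict_vec \<Delta> (- S))) \<le> r * scaled_norm (X *v \<Delta>)"
  shows "scaled_norm (X *v b - f) \<le> scaled_norm (X *v \<beta> - f) + r"
proof -
  let ?n = "real CARD('n)" and ?\<Delta> = "b - \<beta>"
  let ?p = "X *v b - f" and ?q = "X *v \<beta> - f" and ?h = "X *v (b - \<beta>)"
  have sq: "(scaled_norm u)\<^sup>2 = (u \<bullet> u) / ?n" for u :: "real ^ 'n"
    by (simp add: scaled_norm_eq power_divide dot_square_norm)
  have nn: "0 \<le> scaled_norm u" for u :: "real ^ 'n" by (simp add: scaled_norm_eq)
  have \<beta>0: "\<beta> $ j = 0" if "j \<in> - S" for j using that \<beta> by (auto simp: Supp_def)
  have "l1_norm \<beta> - l1_norm b \<le> l1_norm (restrict_vec ?\<Delta> S) - l1_norm (restrict_vec ?\<Delta> (- S))"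
  proof -
    have "(\<Sum>j\<in>S. \<bar>\<beta> $ j\<bar>) \<le> (\<Sum>j\<in>S. \<bar>?\<Delta> $ j\<bar> + \<bar>b $ j\<bar>)" by (intro sum_mono) auto
    moreover have "(\<Sum>j\<in>- S. \<bar>?\<Delta> $ j\<bar>) = (\<Sum>j\<in>- S. \<bar>b $ j\<bar>)" by (intro sum.cong) (auto simp: \<beta>0)
    moreover have "(\<Sum>j\<in>- S. \<bar>\<beta> $ j\<bar>) = 0" by (intro sum.neutral) (auto simp: \<beta>0)
    ultimately show ?thesis
      unfolding l1_norm_split[of \<beta> S] l1_norm_split[of b S] l1_norm_restrict_vec by (simp add: sum.distrib)
  qed
  then have "lam * (l1_norm \<beta> - l1_norm b) \<le> lam * (l1_norm (restrict_vec ?\<Delta> S) - l1_norm (restrict_vec ?\<Delta> (- S)))"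
    using lam by (intro mult_left_mono)
  moreover have "0 \<le> (\<xi> - ?p) \<bullet> ?h / ?n + lam * (l1_norm \<beta> - l1_norm b)"
    using lasso_variational[OF b lam, of \<beta>] by (simp add: diff_diff_eq2 add.commute)
  ultimately have "0 \<le> (\<xi> - ?p) \<bullet> ?h / ?n + lam * (l1_norm (restrict_vec ?\<Delta> S) - l1_norm (restrict_vec ?\<Delta> (- S)))"
    by linarith
  also have "\<dots> \<le> r * scaled_norm ?h - ?p \<bullet> ?h / ?n"
    using noise[of ?\<Delta>] by (simp add: inner_diff_left diff_divide_distrib)
  finally have ph: "?p \<bullet> ?h / ?n \<le> r * scaled_norm ?h" by simp
  have h: "?h = ?p - ?q" by (simp add: matrix_vector_mult_diff_distrib)
  have "2 * (?p \<bullet> ?h) = ?p \<bullet> ?p - ?q \<bullet> ?q + ?h \<bullet> ?h"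
    unfolding h by (simp add: inner_diff_left inner_diff_right inner_commute)
  then have "2 * (?p \<bullet> ?h / ?n) = (scaled_norm ?p)\<^sup>2 - (scaled_norm ?q)\<^sup>2 + (scaled_norm ?h)\<^sup>2"
    unfolding sq by (simp add: diff_divide_distrib add_divide_distrib)
  with ph have "(scaled_norm ?p)\<^sup>2 \<le> (scaled_norm ?q)\<^sup>2 + 2 * (r * scaled_norm ?h) - (scaled_norm ?h)\<^sup>2" by linarith
  also have "\<dots> = (scaled_norm ?q)\<^sup>2 + r\<^sup>2 - (r - scaled_norm ?h)\<^sup>2"
    by (simp add: power2_eq_square algebra_simps)
  also have "\<dots> \<le> (scaled_norm ?q)\<^sup>2 + r\<^sup>2 + 2 * (scaled_norm ?q * r)"
    using mult_nonneg_nonneg[OF nn[of ?q] r] zero_le_power2[of "r - scaled_norm ?h"] by linarith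
  also have "\<dots> = (scaled_norm ?q + r)\<^sup>2" by (simp add: power2_eq_square algebra_simps)
  finally show ?thesis by (rule power2_le_imp_le) (use nn[of ?q] r in simp)
qed

text \<open>The estimator itself need not be measurable, but its fit is a nonexpansive function of the
  noise, so that the event is the preimage of a closed set.\<close>

lemma lasso_fit_event:
  fixes X :: "real ^ 'p ^ 'n" and \<xi> :: "'a \<Rightarrow> real ^ 'n"
  assumes \<xi>: "\<xi> \<in> borel_measurable M" and lam: "0 \<le> lam"
    and lasso: "\<And>\<omega>. \<omega> \<in> space M \<Longrightarrow> is_lasso X (f + \<xi> \<omega>) lam (b \<omega>)"
  shows "{\<omega> \<in> space M. scaled_norm (X *v b \<omega> - f) \<le> c} \<in> sets M"
proof -
  let ?n = "sqrt (real CARD('n))"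
  define G where "G = {\<omega> \<in> space M. scaled_norm (X *v b \<omega> - f) \<le> c}"
  have iff: "\<omega> \<in> G \<longleftrightarrow> norm (X *v b \<omega> - f) \<le> c * ?n" if "\<omega> \<in> space M" for \<omega>
    using that by (simp add: G_def scaled_norm_eq pos_divide_le_eq)
  \<comment> \<open>The closed set is the closure of the noise values of the event itself;
    nonexpansiveness shows that taking the closure adds no outcome.\<close>
  have "G = \<xi> -` closure (\<xi> ` G) \<inter> space M"
  proof (intro set_eqI iffI)
    fix \<omega> assume "\<omega> \<in> \<xi> -` closure (\<xi> ` G) \<inter> space M"
    then have \<omega>: "\<omega> \<in> space M" "\<xi> \<omega> \<in> closure (\<xi> ` G)" by auto
    have "norm (X *v b \<omega> - f) \<le> c * ?n + e" if e: "0 < e" for e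
    proof -
      obtain \<omega>' where \<omega>': "\<omega>' \<in> G" "dist (\<xi> \<omega>') (\<xi> \<omega>) < e"
        using \<omega>(2) e unfolding closure_approachable by blast
      then have sp: "\<omega>' \<in> space M" by (simp add: G_def)
      have "X *v b \<omega> - f = (X *v b \<omega>' - f) + (X *v b \<omega> - X *v b \<omega>')" by simp
      then have "norm (X *v b \<omega> - f) \<le> norm (X *v b \<omega>' - f) + norm (X *v b \<omega> - X *v b \<omega>')"
        by (metis norm_triangle_ineq)
      also have "norm (X *v b \<omega> - X *v b \<omega>') \<le> norm ((f + \<xi> \<omega>) - (f + \<xi> \<omega>'))"
        by (rule lasso_fit_nonexpansive[OF lasso lasso lam]) fact+
      also have "\<dots> \<le> e" using \<omega>'(2) by (simp add: dist_norm norm_minus_commute)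
      finally show ?thesis using iff[OF sp] \<omega>'(1) by simp
    qed
    then have "norm (X *v b \<omega> - f) \<le> c * ?n" by (rule field_le_epsilon)
    then show "\<omega> \<in> G" using iff[OF \<omega>(1)] by simp
  next
    fix \<omega> assume "\<omega> \<in> G"
    then show "\<omega> \<in> \<xi> -` closure (\<xi> ` G) \<inter> space M" using closure_subset[of "\<xi> ` G"] by (auto simp: G_def)
  qed
  also have "\<dots> \<in> sets M" using \<xi> by (rule measurable_sets) simp
  finally show ?thesis by (simp add: G_def)
qed

subsection \<open>The oracle inequality\<close>

lemma RE_const_le:
  fixes X :: "real ^ 'p ^ 'n"
  assumes "S \<noteq> {}" "0 < c0" "\<Delta> \<in> RE_cone S c0" and pos: "0 \<le> RE_const X S c0"
  shows "RE_const X S c0 * norm \<Delta> \<le> scaled_norm (X *v \<Delta>)"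
proof (cases "\<Delta> = 0")
  case False
  then have "(RE_const X S c0)\<^sup>2 \<le> (scaled_norm (X *v \<Delta>))\<^sup>2 / (norm \<Delta>)\<^sup>2"
    using RE_const_attained[OF assms(1,2), of X] assms(3) by (metis Diff_iff singletonD)
  then have "(RE_const X S c0 * norm \<Delta>)\<^sup>2 \<le> (scaled_norm (X *v \<Delta>))\<^sup>2"
    using False by (simp add: power_mult_distrib pos_le_divide_eq)
  then show ?thesis by (rule power2_le_imp_le) (simp add: scaled_norm_eq)
qed (simp add: scaled_norm_eq)

section \<open>Comparison of the exponent with the power of \<open>p\<close>\<close>

context restricted_eigenvalue
begin

lemma t_sq: "t\<^sup>2 = 4 * lam\<^sup>2 * card S / \<kappa>\<^sup>2"
  by (simp add: t_def power_mult_distrib power_divide)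

text \<open>Combine \<open>lam\<^sup>2 \<ge> 8 * ln p\<close> with \<open>\<kappa> \<le> 1\<close>;
  half of 32 is the 16 in the final exponent.\<close>

lemma t_sq_ge: "32 * real (card S) * ln (real CARD('p)) \<le> t\<^sup>2"
proof -
  have "(2 * sqrt (2 * ln (real CARD('p))))\<^sup>2 \<le> lam\<^sup>2" using lam ln_p by (intro power_mono) auto
  then have "8 * ln (real CARD('p)) \<le> lam\<^sup>2" using ln_p by (simp add: power_mult_distrib)
  then have "32 * real (card S) * ln (real CARD('p)) \<le> 4 * lam\<^sup>2 * card S"
    using mult_left_mono[of "8 * ln (real CARD('p))" "lam\<^sup>2" "4 * real (card S)"] by (simp add: mult_ac)
  also have "\<dots> \<le> 4 * lam\<^sup>2 * card S / \<kappa>\<^sup>2"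
  proof -
    have "\<kappa>\<^sup>2 \<le> 1" using \<kappa> \<kappa>_le_1 by (simp add: power_le_one)
    then have "4 * lam\<^sup>2 * card S * \<kappa>\<^sup>2 \<le> 4 * lam\<^sup>2 * card S" by (intro mult_left_le) auto
    then show ?thesis using \<kappa> by (subst pos_le_divide_eq) auto
  qed
  finally show ?thesis by (simp add: t_sq)
qed

lemma exp_le_powr: "exp (- t\<^sup>2 / 2) \<le> real CARD('p) powr (- 16 * real (card S))"
  using t_sq_ge card by (simp add: powr_def mult_ac)

end

theorem mainTheorem4:
  fixes M :: "'a measure"
    and \<sigma> lam :: real
    and f :: "real ^ 'n"
    and \<xi> y :: "'a \<Rightarrow> real ^ 'n"
    and X :: "real ^ 'p ^ 'n"
    and \<beta>hat :: "'a \<Rightarrow> real ^ 'p"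
    and S :: "'p set"
    and s :: nat
  assumes "prob_space M"
    and "CARD('p) \<ge> 2"
    and "\<sigma> > 0"
    and "distributed M lborel \<xi> (multivariate_normal_density 0 (\<sigma>\<^sup>2 *\<^sub>R mat 1))"
    and "\<And>\<omega>. \<omega> \<in> space M \<Longrightarrow> y \<omega> = f + \<xi> \<omega>"
    and "\<And>j. ((1 / real CARD('n)) *\<^sub>R (transpose X ** X)) $ j $ j \<le> 1"
    and "lam \<ge> 2 * \<sigma> * sqrt (2 * ln (real CARD('p)) / real CARD('n))"
    and "\<And>\<omega>. \<omega> \<in> space M \<Longrightarrow> is_lasso X (y \<omega>) lam (\<beta>hat \<omega>)"
    and "S \<noteq> {}"
    and "RE_const X S 3 > 0"
    and "s = card S"
  shows "measure M {\<omega> \<in> space M.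
             scaled_norm (X *v \<beta>hat \<omega> - f)
               \<le> (INF \<beta> \<in> {\<beta>. Supp \<beta> = S}. scaled_norm (X *v \<beta> - f))
                  + 7 * lam * sqrt (real (card S)) / (2 * RE_const X S 3)}
           \<ge> 1 - exp (- 2 * real s * lam\<^sup>2 * real CARD('n) / (\<sigma>\<^sup>2 * (RE_const X S 3)\<^sup>2))
       \<and> 1 - exp (- 2 * real s * lam\<^sup>2 * real CARD('n) / (\<sigma>\<^sup>2 * (RE_const X S 3)\<^sup>2))
           \<ge> 1 - real CARD('p) powr (- 16 * real s)"
proof -
  interpret prob_space M by fact
  define \<kappa> where "\<kappa> = RE_const X S 3"
  define c where "c = sqrt (real CARD('n))"
  define Y where "Y = (1 / c) *\<^sub>R X"
  define lam' where "lam' = lam * c / \<sigma>"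
  define t where "t = 2 * lam' * sqrt (card S) / \<kappa>"
  define r where "r = 7 * lam * sqrt (real (card S)) / (2 * \<kappa>)"
  have \<sigma>: "0 < \<sigma>" and \<kappa>: "0 < \<kappa>" and c: "0 < c" and c2: "c\<^sup>2 = real CARD('n)"
    using assms by (auto simp: \<kappa>_def c_def)
  have Yv: "Y *v \<Delta> = (1 / c) *\<^sub>R (X *v \<Delta>)" for \<Delta>
    by (simp add: Y_def scaleR_matrix_vector_assoc)
  have nY: "norm (Y *v \<Delta>) = scaled_norm (X *v \<Delta>)" for \<Delta>
    using c by (simp add: Yv scaled_norm_eq c_def)
  interpret restricted_eigenvalue Y S \<kappa> lam' t
  proof
    fix j
    have diag: "((1 / real CARD('n)) *\<^sub>R (transpose X ** X)) $ j $ j = (norm (column j Y))\<^sup>2"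
    proof -
      have "column j Y = (1 / c) *\<^sub>R column j X" by (simp add: Y_def column_def vec_eq_iff)
      then have "(norm (column j Y))\<^sup>2 = (norm (column j X))\<^sup>2 / c\<^sup>2" using c by (simp add: power_divide)
      then show ?thesis
        by (simp add: c2 matrix_matrix_mult_def transpose_def column_def power2_norm_eq_inner inner_vec_def)
    qed
    have "(norm (column j Y))\<^sup>2 \<le> 1\<^sup>2" using assms(6)[of j] unfolding diag by simp
    then show "norm (column j Y) \<le> 1" by (rule power2_le_imp_le) simp
  next
    show "\<kappa> * norm \<Delta> \<le> norm (Y *v \<Delta>)" if "\<Delta> \<in> RE_cone S 3" for \<Delta>
      using RE_const_le[OF assms(9) _ that, of X] \<kappa> by (simp add: nY \<kappa>_def)
    have "2 * sqrt (2 * ln (real CARD('p))) = 2 * \<sigma> * sqrt (2 * ln (real CARD('p)) / real CARD('n)) * c / \<sigma>"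
      using \<sigma> c by (simp add: real_sqrt_divide c_def[symmetric])
    also have "\<dots> \<le> lam'" unfolding lam'_def
      using assms(7) \<sigma> c by (intro divide_right_mono mult_right_mono) auto
    finally show "2 * sqrt (2 * ln (real CARD('p))) \<le> lam'" .
  qed (use assms \<kappa> in \<open>auto simp: t_def\<close>)
  have lam: "0 \<le> lam"
    using lam_pos \<sigma> c by (simp add: lam'_def zero_less_divide_iff zero_less_mult_iff)
  have r: "0 \<le> r" using lam \<kappa> by (simp add: r_def)
  have exponent: "- 2 * real s * lam\<^sup>2 * real CARD('n) / (\<sigma>\<^sup>2 * (RE_const X S 3)\<^sup>2) = - t\<^sup>2 / 2"
    using \<sigma> \<kappa> unfolding t_sq by (simp add: lam'_def c2[symmetric] assms(11) \<kappa>_def[symmetric] power_mult_distrib power_divide mult_ac)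
  define I where "I = (INF \<beta> \<in> {\<beta>. Supp \<beta> = S}. scaled_norm (X *v \<beta> - f))"
  define G where "G = {\<omega> \<in> space M. scaled_norm (X *v \<beta>hat \<omega> - f) \<le> I + r}"
  have lasso: "is_lasso X (f + \<xi> \<omega>) lam (\<beta>hat \<omega>)" if "\<omega> \<in> space M" for \<omega>
    using assms(5,8) that by metis
  have \<xi> [measurable]: "\<xi> \<in> borel_measurable M" using distributed_measurable[OF assms(4)] by simp
  have G: "G \<in> sets M"
    unfolding G_def by (rule lasso_fit_event[OF \<xi> lam lasso])
  \<comment> \<open>This event does not involve \<open>\<beta>\<close>, so off it the oracle
    inequality holds for all \<open>\<beta>\<close> at once and passes to the infimum.\<close>
  define Bad where "Bad = {\<omega> \<in> space M. (1 / \<sigma>) *\<^sub>R \<xi> \<omega> \<in> bad UNIV (7 / 4 * t)}"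
  have Bad: "Bad \<in> sets M" unfolding Bad_def by measurable
  have "measure M Bad = measure (distr M borel (\<lambda>\<omega>. (1 / \<sigma>) *\<^sub>R \<xi> \<omega>)) (bad UNIV (7 / 4 * t))"
    by (subst measure_distr) (auto simp: Bad_def intro!: arg_cong[where f="measure M"])
  also have "\<dots> \<le> exp (- t\<^sup>2 / 2)"
    unfolding distr_multivariate_normal[OF assms(4) \<sigma>] by (rule prob_bad)
  finally have PB: "measure M Bad \<le> exp (- t\<^sup>2 / 2)" .
  have "space M - Bad \<subseteq> G"
  proof
    fix \<omega> assume "\<omega> \<in> space M - Bad"
    then have \<omega>: "\<omega> \<in> space M"
      and good: "\<And>\<Delta>. (1 / \<sigma>) *\<^sub>R \<xi> \<omega> \<bullet> (Y *v \<Delta>) + lam' * excess_penalty \<Delta> \<le> 7 / 4 * t * norm (Y *v \<Delta>)"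
      by (auto simp: Bad_def bad_def not_less)
    have noise: "\<xi> \<omega> \<bullet> (X *v \<Delta>) / real CARD('n)
          + lam * (l1_norm (restrict_vec \<Delta> S) - l1_norm (restrict_vec \<Delta> (- S))) \<le> r * scaled_norm (X *v \<Delta>)" for \<Delta>
    proof -
      \<comment> \<open>The factor \<open>\<sigma> / c\<close> undoes the normalisation: it sends
        \<open>lam'\<close> to \<open>lam\<close> and \<open>7 / 4 * t\<close> to
        \<open>r\<close>.\<close>
      have "\<sigma> / c * ((1 / \<sigma>) *\<^sub>R \<xi> \<omega> \<bullet> (Y *v \<Delta>) + lam' * excess_penalty \<Delta>)
          \<le> \<sigma> / c * (7 / 4 * t * norm (Y *v \<Delta>))"
        using good[of \<Delta>] \<sigma> c by (intro mult_left_mono) auto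
      also have "\<sigma> / c * (7 / 4 * t * norm (Y *v \<Delta>)) = r * scaled_norm (X *v \<Delta>)"
        using \<sigma> c by (simp add: nY t_def r_def lam'_def)
      also have "\<sigma> / c * ((1 / \<sigma>) *\<^sub>R \<xi> \<omega> \<bullet> (Y *v \<Delta>) + lam' * excess_penalty \<Delta>)
          = \<xi> \<omega> \<bullet> (X *v \<Delta>) / c\<^sup>2 + lam * excess_penalty \<Delta>"
        using \<sigma> c by (simp add: Yv lam'_def distrib_left power2_eq_square)
      finally show ?thesis by (simp add: excess_penalty_def c2)
    qed
    have "scaled_norm (X *v \<beta>hat \<omega> - f) - r \<le> I"
      unfolding I_def
    proof (rule cINF_greatest)
      have "Supp (\<chi> j. if j \<in> S then 1 else 0 :: real ^ 'p) = S" by (auto simp: Supp_def)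
      then show "{\<beta> :: real ^ 'p. Supp \<beta> = S} \<noteq> {}" by blast
      fix \<beta> :: "real ^ 'p" assume "\<beta> \<in> {\<beta>. Supp \<beta> = S}"
      then have "Supp \<beta> = S" by simp
      from lasso_oracle_inequality[OF lasso[OF \<omega>] lam this r noise]
      show "scaled_norm (X *v \<beta>hat \<omega> - f) - r \<le> scaled_norm (X *v \<beta> - f)" by simp
    qed
    then show "\<omega> \<in> G" using \<omega> by (simp add: G_def)
  qed
  then have "measure M (space M - Bad) \<le> measure M G" using G by (rule finite_measure_mono)
  then have "1 - exp (- t\<^sup>2 / 2) \<le> measure M G" using PB prob_compl[OF Bad] by linarith
  then show ?thesis
    unfolding exponent using exp_le_powr by (simp add: G_def I_def r_def \<kappa>_def assms(11))
qed

end
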